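(* Assume the Riemann Hypothesis. For a simple zero $\rho=1/2+i\gamma$ ($\gamma$ real) of $\zeta(s)$, $$-P\Xi^\prime(\gamma)=\operatorname{Re}\left(\left(\frac{\eta^\prime}{\eta}\right)^\prime(\rho)\right)+\left(\operatorname{Re}\left(\frac{h^\prime}{h}(\rho)\right)\right)^2+\operatorname{Im}\left(\frac{\eta^\prime}{\eta}(\rho)\right)\operatorname{Im}\left(\frac{h^\prime}{h}(\rho)\right)+2\operatorname{Re}\left(\left(\frac{h^\prime}{h}\right)^\prime(\rho)\right).$$
   Context: Let $h(s)=\frac12 s(s-1)\pi^{-s/2}\Gamma(s/2)$, $\xi(s)=h(s)\zeta(s)$, $\Xi(t)=\xi(1/2+it)$, and $\eta(s)=h(s)\zeta^\prime(s)$. For an analytic function $f$, the pre-Schwarzian is $Pf(z)=\dfrac{f''(z)}{f'(z)}$. By convention $P$ has priority over the derivative: $Pf^\prime(z)$ means $\left(\dfrac{f''(z)}{f'(z)}\right)^\prime$ (the derivative of $Pf$), not $f'''(z)/f''(z)$. *)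

theory Defs
  imports "HOL-Complex_Analysis.Complex_Analysis"
begin

text \<open>
  The Riemann zeta function is the analytic continuation of its Dirichlet series to the plane
  without the point 1. By the identity theorem these two conditions determine it off the pole;
  the value 0 at the pole is a convention that makes the description unique.
\<close>

definition zeta :: "complex \<Rightarrow> complex" where
  "zeta = (THE f. f holomorphic_on (- {1}) \<and>
                  (\<forall>s. Re s > 1 \<longrightarrow> (\<lambda>n. 1 / of_nat (Suc n) powr s) sums f s) \<and>
                  f 1 = 0)"

text \<open>
  The restriction to the open critical strip removes the trivial zeros as well as the
  conventional value at the pole.
\<close>

definition Riemann_Hypothesis :: bool where
  "Riemann_Hypothesis \<longleftrightarrow>
     (\<forall>s. zeta s = 0 \<longrightarrow> 0 < Re s \<longrightarrow> Re s < 1 \<longrightarrow> Re s = 1/2)"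

text \<open>
  The library has \<^term>\<open>Gamma z = 0\<close> at the poles of Gamma, so the function h below vanishes at
  0, -2, -4, and so on. The pointwise products with h therefore agree with the usual analytic
  functions except possibly at 1, 0, -2, -4, and so on, none of which lies on the critical line.
\<close>

definition h :: "complex \<Rightarrow> complex" where
  "h s = 1/2 * s * (s - 1) * of_real pi powr (- s / 2) * Gamma (s / 2)"

definition xi :: "complex \<Rightarrow> complex" where
  "xi s = h s * zeta s"

definition Xi :: "complex \<Rightarrow> complex" where
  "Xi t = xi (1/2 + \<i> * t)"

definition eta :: "complex \<Rightarrow> complex" where
  "eta s = h s * deriv zeta s"

definition pre_Schwarzian :: "(complex \<Rightarrow> complex) \<Rightarrow> complex \<Rightarrow> complex" where
  "pre_Schwarzian f z = deriv (deriv f) z / deriv f z"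

end

theory Submission
  imports Defs "HOL-Real_Asymp.Real_Asymp"
begin

text \<open>
  Write L = h'/h and M = eta'/eta. Since Xi(t) = xi(1/2 + it), the derivative of the pre-Schwarzian
  satisfies -P Xi'(gamma) = (xi''/xi')'(rho). At rho the factor zeta of xi = h zeta vanishes, so
  xi'(rho) = eta(rho) and only few terms of the product rule survive
  (\<open>deriv_log_deriv_product_at_simple_zero\<close>):
  xi''/xi' = M + L and (xi''/xi')' = M' + 2 L' - L M at rho.
  Simplicity of the zero makes eta(rho) nonzero, hence the quotients meaningful.

  The remaining input is that Xi is real on the real axis (\<open>Xi_real\<close>). Then P Xi and its derivative
  are real at gamma. The first fact says that i (M + L) is real at rho, that is Re M = - Re L; the
  second allows replacing M' + 2 L' - L M by its real part, in which
  - Re (L M) = - Re L Re M + Im L Im M = (Re L)^2 + Im L Im M. This is the asserted formula.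

  Reality of Xi is the functional equation in disguise, and zeta is only described by its
  Dirichlet series and holomorphy, so the continuation is constructed on the way. With
  omega(x) = exp (- pi x) + exp (- 4 pi x) + exp (- 9 pi x) + ... (\<open>theta_tail\<close>), Riemann's argument
  splits the Mellin integral of omega at 1 and maps (0,1] to [1,oo) by the theta transformation
  (\<open>theta_tail_reciprocal\<close>). The outcome (\<open>xi_eq\<close>) is
  2 xi(s) = s (s - 1) (E(s/2) + E((1 - s)/2)) + 1
  with the entire function E(a) given by the integral of omega(x) x^(a-1) over [1,oo). On the critical
  line 1 - s is the conjugate of s and E commutes with conjugation, so the right-hand side is real.

  The theta transformation itself is obtained as a limit of finite identities, following Polya:
  averaging (2 cos u)^(2m) over the multiples u of pi/l picks out every l-th binomial coefficient
  around the central one (\<open>discrete_theta_identity\<close>). If m grows like a constant times l^2, both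
  sides become Gaussian sums, and Tannery's theorem justifies the passage to the limit.
\<close>

section \<open>Ratios of binomial coefficients near the centre\<close>

text \<open>
  The common source of both Gaussian limits below: it is applied with x = sin^2 for the powers of
  cosines and with x = r/(m + O(r)) for the ratios of binomial coefficients.
\<close>
lemma power_one_minus_tendsto_exp:
  fixes x :: "nat \<Rightarrow> real" and r :: "nat \<Rightarrow> nat"
  assumes x: "x \<longlonglongrightarrow> 0" and rx: "(\<lambda>n. real (r n) * x n) \<longlonglongrightarrow> c"
  shows "(\<lambda>n. (1 - x n) ^ r n) \<longlonglongrightarrow> exp (- c)"
proof -
  \<comment> \<open>The quotient q is continuous at 0 once its value there is set to 1; this avoids a case distinction on x n = 0.\<close>
  define q where "q = (\<lambda>y::real. if y = 0 then 1 else ln (1 - y) / (- y))"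
  have "((\<lambda>y::real. ln (1 - y) / (- y)) \<longlongrightarrow> 1) (at 0)"
    by real_asymp
  hence "(q \<longlongrightarrow> 1) (at 0)"
    by (rule Lim_transform_eventually) (auto simp: q_def eventually_at_filter)
  hence "isCont q 0"
    unfolding isCont_def by (simp add: q_def)
  hence q: "(\<lambda>n. q (x n)) \<longlonglongrightarrow> 1"
    using x isCont_tendsto_compose[of 0 q x sequentially] by (simp add: q_def)
  have lim: "(\<lambda>n. exp (- (real (r n) * x n * q (x n)))) \<longlonglongrightarrow> exp (- (c * 1))"
    by (intro tendsto_intros rx q)
  have "eventually (\<lambda>n. x n < 1) sequentially"
    using order_tendstoD(2)[OF x] by simp
  hence "eventually (\<lambda>n. exp (- (real (r n) * x n * q (x n))) = (1 - x n) ^ r n) sequentially"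
  proof eventually_elim
    case (elim n)
    have "x n * q (x n) = - ln (1 - x n)"
      by (simp add: q_def)
    hence "- (real (r n) * x n * q (x n)) = real (r n) * ln (1 - x n)"
      by (simp add: mult.assoc)
    also have "exp \<dots> = (1 - x n) ^ r n"
      using elim by (simp add: exp_of_nat_mult)
    finally show ?case .
  qed
  from Lim_transform_eventually[OF lim this] show ?thesis by simp
qed

text \<open>
  Domination for Tannery's theorem on the trigonometric side. The product of exp (u^2/2) and cos u
  decreases because u cos u - sin u is nonpositive, which in turn follows by differentiation.
\<close>
lemma cos_le_exp_neg_square:
  fixes u :: real
  assumes "0 \<le> u" "u \<le> pi / 2"
  shows "cos u \<le> exp (- (u\<^sup>2 / 2))"
proof -
  have "exp (u\<^sup>2 / 2) * cos u \<le> exp (0\<^sup>2 / 2) * cos 0"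
  proof (rule DERIV_nonpos_imp_nonincreasing[OF assms(1)])
    fix y assume y: "0 \<le> y" "y \<le> u"
    have "((\<lambda>u. exp (u\<^sup>2 / 2) * cos u) has_real_derivative
        exp (y\<^sup>2 / 2) * (y * cos y - sin y)) (at y)"
      by (auto intro!: derivative_eq_intros simp: algebra_simps)
    moreover have "y * cos y \<le> sin y"
    proof -
      have "sin 0 - 0 * cos 0 \<le> sin y - y * cos y"
      proof (rule DERIV_nonneg_imp_nondecreasing[OF y(1)])
        fix v assume v: "0 \<le> v" "v \<le> y"
        have "((\<lambda>v. sin v - v * cos v) has_real_derivative v * sin v) (at v)"
          by (auto intro!: derivative_eq_intros)
        moreover have "0 \<le> v * sin v"
          using v y assms by (intro mult_nonneg_nonneg sin_ge_zero) auto
        ultimately show "\<exists>d. ((\<lambda>v. sin v - v * cos v) has_real_derivative d) (at v) \<and> 0 \<le> d"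
          by blast
      qed
      thus ?thesis by simp
    qed
    ultimately show "\<exists>d. ((\<lambda>u. exp (u\<^sup>2 / 2) * cos u) has_real_derivative d) (at y) \<and> d \<le> 0"
      by (intro exI[of _ "exp (y\<^sup>2 / 2) * (y * cos y - sin y)"]) (auto simp: mult_le_0_iff)
  qed
  thus ?thesis by (simp add: exp_minus field_simps)
qed

definition central_ratio :: "nat \<Rightarrow> nat \<Rightarrow> real" where
  "central_ratio m r = real ((2 * m) choose (m + r)) / real ((2 * m) choose m)"

text \<open>
  In this form all factors are comparable: each lies between 1 - r/(m + 1) and 1 - r/(m + r). The
  factors of the product obtained directly from the recursion would not be.
\<close>
lemma central_ratio_eq_prod:
  assumes "r \<le> m"
  shows "central_ratio m r = (\<Prod>j<r. 1 - real r / real (m + r - j))"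
proof -
  have 1: "real ((2*m) choose (m + r)) * (\<Prod>j<r. real (m + j + 1)) =
           real ((2*m) choose m) * (\<Prod>j<r. real (m - j))"
    using assms
  proof (induction r)
    case (Suc r)
    have "(2*m choose Suc (m + r)) * Suc (m + r) = (2*m choose (m + r)) * (m - r)"
      using binomial_absorb_comp[of "2*m" "m+r"] Suc.prems
      by (metis (no_types, lifting) ab_semigroup_mult_class.mult_ac(1) add_diff_cancel_left' binomial_absorption diff_diff_left mult.commute mult_2)
    hence *: "real (2*m choose Suc (m + r)) * real (m + r + 1) = real (2*m choose (m + r)) * real (m - r)"
      by (metis Suc_eq_plus1 of_nat_mult)
    have "real ((2*m) choose (m + Suc r)) * (\<Prod>j<Suc r. real (m + j + 1)) =
          (real (2*m choose Suc (m + r)) * real (m + r + 1)) * (\<Prod>j<r. real (m + j + 1))"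
      by (simp add: mult_ac)
    also have "\<dots> = real (m - r) * (real (2*m choose (m + r)) * (\<Prod>j<r. real (m + j + 1)))"
      unfolding * by (simp add: mult_ac)
    also have "\<dots> = real (m - r) * (real ((2*m) choose m) * (\<Prod>j<r. real (m - j)))"
      using Suc by simp
    finally show ?case by (simp add: mult_ac)
  qed simp
  \<comment> \<open>Reversing the denominator pairs m - j with m + r - j, whose difference is the constant r.\<close>
  have 2: "(\<Prod>j<r. real (m + j + 1)) = (\<Prod>j<r. real (m + r - j))"
    by (subst prod.nat_diff_reindex[symmetric]) (intro prod.cong, auto)
  have 3: "(\<Prod>j<r. real (m - j)) / (\<Prod>j<r. real (m + r - j)) = (\<Prod>j<r. 1 - real r / real (m + r - j))"
    unfolding prod_dividef[symmetric]
  proof (rule prod.cong)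
    fix j assume "j \<in> {..<r}"
    hence eq: "real (m - j) = real (m + r - j) - real r" and pos: "real (m + r - j) > 0"
      using assms by auto
    show "real (m - j) / real (m + r - j) = 1 - real r / real (m + r - j)"
      using pos unfolding eq by (simp only: diff_divide_distrib divide_self)
  qed simp
  have pos: "(\<Prod>j<r. real (m + r - j)) > 0" using assms by (intro prod_pos) auto
  have C: "real ((2*m) choose m) > 0" by simp
  have "central_ratio m r = (\<Prod>j<r. real (m - j)) / (\<Prod>j<r. real (m + r - j))"
    using 1 pos C unfolding 2 central_ratio_def by (simp add: frac_eq_eq mult.commute)
  thus ?thesis using 3 by simp
qed

lemma central_ratio_eq_0: "r > m \<Longrightarrow> central_ratio m r = 0"
  by (simp add: central_ratio_def)

lemma central_ratio_nonneg: "0 \<le> central_ratio m r"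
  by (simp add: central_ratio_def)

lemma central_ratio_bounds:
  assumes "r \<le> m"
  shows "(1 - real r / real (m + 1)) ^ r \<le> central_ratio m r"
    and "central_ratio m r \<le> (1 - real r / real (m + r)) ^ r"
proof -
  have "(\<Prod>j<r. 1 - real r / real (m + 1)) \<le> (\<Prod>j<r. 1 - real r / real (m + r - j))"
  proof (rule prod_mono)
    fix j assume j: "j \<in> {..<r}"
    have "real r / real (m + r - j) \<le> real r / real (m + 1)"
      using j assms by (intro divide_left_mono) auto
    moreover have "real r / real (m + 1) \<le> 1" using assms by simp
    ultimately show "0 \<le> 1 - real r / real (m + 1) \<and>
          1 - real r / real (m + 1) \<le> 1 - real r / real (m + r - j)"
      by simp
  qed
  thus "(1 - real r / real (m + 1)) ^ r \<le> central_ratio m r"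
    using central_ratio_eq_prod[OF assms] by simp
  have "(\<Prod>j<r. 1 - real r / real (m + r - j)) \<le> (\<Prod>j<r. 1 - real r / real (m + r))"
  proof (rule prod_mono)
    fix j assume j: "j \<in> {..<r}"
    have "real r / real (m + r) \<le> real r / real (m + r - j)"
      using j assms by (intro divide_left_mono) auto
    moreover have "real r / real (m + r - j) \<le> 1" using j assms by simp
    ultimately show "0 \<le> 1 - real r / real (m + r - j) \<and>
          1 - real r / real (m + r - j) \<le> 1 - real r / real (m + r)"
      by simp
  qed
  thus "central_ratio m r \<le> (1 - real r / real (m + r)) ^ r"
    using central_ratio_eq_prod[OF assms] by simp
qed

text \<open>
  Domination for Tannery's theorem on the binomial side.
\<close>
lemma central_ratio_le_exp: "central_ratio m r \<le> exp (- (real r ^ 2 / (2 * real m)))"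
proof (cases "r \<le> m")
  case True
  show ?thesis
  proof (cases "r = 0")
    case False
    hence m: "m > 0" using True by simp
    have "real r / (2 * real m) \<le> real r / real (m + r)"
      using True m by (intro divide_left_mono) auto
    hence "1 - real r / real (m + r) \<le> 1 + (- (real r / (2 * real m)))" by simp
    also have "\<dots> \<le> exp (- (real r / (2 * real m)))" by (rule exp_ge_add_one_self)
    finally have le: "1 - real r / real (m + r) \<le> exp (- (real r / (2 * real m)))" .
    have "central_ratio m r \<le> (1 - real r / real (m + r)) ^ r"
      by (rule central_ratio_bounds[OF True])
    also have "\<dots> \<le> exp (- (real r / (2 * real m))) ^ r"
      using le m by (intro power_mono) auto
    also have "\<dots> = exp (- (real r ^ 2 / (2 * real m)))"
      by (simp add: exp_of_nat_mult[symmetric] power2_eq_square)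
    finally show ?thesis .
  qed (simp add: central_ratio_def)
qed (simp add: central_ratio_eq_0)

text \<open>
  A local central limit theorem without error term: the product bounds squeeze the ratio between two
  powers of the same shape, and r/m tends to 0 because r^2/m converges.
\<close>
lemma central_ratio_tendsto:
  assumes m: "filterlim m at_top sequentially"
    and r: "(\<lambda>n. real (r n) ^ 2 / real (m n)) \<longlonglongrightarrow> c"
  shows "(\<lambda>n. central_ratio (m n) (r n)) \<longlonglongrightarrow> exp (- c)"
proof -
  have mr: "filterlim (\<lambda>n. real (m n)) at_top sequentially"
    by (rule filterlim_compose[OF filterlim_real_sequentially m])
  have inv: "(\<lambda>n. 1 / real (m n)) \<longlonglongrightarrow> 0"
    using mr by (intro tendsto_divide_0[OF tendsto_const] filterlim_at_top_imp_at_infinity)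
  have ev: "eventually (\<lambda>n. m n > 0) sequentially"
    using m eventually_gt_at_top[of "0::nat"] unfolding filterlim_iff by blast
  have "(\<lambda>n. sqrt (real (r n) ^ 2 / real (m n) * (1 / real (m n)))) \<longlonglongrightarrow> sqrt (c * 0)"
    by (intro tendsto_intros r inv)
  moreover have "sqrt (real (r n) ^ 2 / real (m n) * (1 / real (m n))) = real (r n) / real (m n)" for n
  proof -
    have "real (r n) ^ 2 / real (m n) * (1 / real (m n)) = (real (r n) / real (m n))\<^sup>2"
      by (simp add: power2_eq_square)
    thus ?thesis by (simp add: real_sqrt_abs)
  qed
  ultimately have q: "(\<lambda>n. real (r n) / real (m n)) \<longlonglongrightarrow> 0" by simp
  have "eventually (\<lambda>n. real (r n) / real (m n) < 1) sequentially"
    using order_tendstoD(2)[OF q, of 1] by simp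
  hence le: "eventually (\<lambda>n. r n \<le> m n) sequentially"
    using ev by eventually_elim (simp add: field_simps)
  have gen: "(\<lambda>n. (1 - real (r n) / real (m n + s n)) ^ r n) \<longlonglongrightarrow> exp (- c)"
    if s: "(\<lambda>n. real (s n) / real (m n)) \<longlonglongrightarrow> 0" for s
  proof (rule power_one_minus_tendsto_exp)
    have *: "(\<lambda>n. X n / (1 + real (s n) / real (m n))) \<longlonglongrightarrow> L" if "X \<longlonglongrightarrow> L" for X :: "nat \<Rightarrow> real" and L
      using tendsto_divide[OF that tendsto_add[OF tendsto_const s, of 1]] by simp
    have eq: "eventually (\<lambda>n. real (r n) / real (m n) / (1 + real (s n) / real (m n)) = real (r n) / real (m n + s n)) sequentially"
      using ev by eventually_elim (simp add: divide_simps)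
    show "(\<lambda>n. real (r n) / real (m n + s n)) \<longlonglongrightarrow> 0"
      using *[OF q] tendsto_cong[OF eq] by simp
    have eq: "eventually (\<lambda>n. real (r n) ^ 2 / real (m n) / (1 + real (s n) / real (m n)) = real (r n) * (real (r n) / real (m n + s n))) sequentially"
      using ev by eventually_elim (simp add: divide_simps power2_eq_square)
    show "(\<lambda>n. real (r n) * (real (r n) / real (m n + s n))) \<longlonglongrightarrow> c"
      using *[OF r] tendsto_cong[OF eq] by simp
  qed
  show ?thesis
  proof (rule tendsto_sandwich)
    show "(\<lambda>n. (1 - real (r n) / real (m n + 1)) ^ r n) \<longlonglongrightarrow> exp (- c)"
      using inv by (intro gen) simp
    show "(\<lambda>n. (1 - real (r n) / real (m n + r n)) ^ r n) \<longlonglongrightarrow> exp (- c)"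
      by (intro gen q)
    show "\<forall>\<^sub>F n in sequentially. (1 - real (r n) / real (m n + 1)) ^ r n \<le> central_ratio (m n) (r n)"
      using le by eventually_elim (rule central_ratio_bounds)
    show "\<forall>\<^sub>F n in sequentially. central_ratio (m n) (r n) \<le> (1 - real (r n) / real (m n + r n)) ^ r n"
      using le by eventually_elim (rule central_ratio_bounds)
  qed
qed

text \<open>
  Euler's product for 1/Gamma at 1/2 is, up to a factor tending to 1, the sequence on the left. The
  limit is therefore 1/Gamma (1/2), and Gamma (1/2) = sqrt pi.
\<close>
lemma central_binomial_tendsto:
  "(\<lambda>m. sqrt (real m) * real ((2 * m) choose m) / 4 ^ m) \<longlonglongrightarrow> 1 / sqrt pi"
proof -
  have poch: "pochhammer (1/2 :: real) m = fact (2 * m) / (4 ^ m * fact m)" for m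
    using fact_double[of m, where 'a = real] by (simp add: field_simps power_mult power2_eq_square flip: power_mult_distrib)
  have eq: "rGamma_series (1/2 :: real) m = (sqrt (real m) * real ((2 * m) choose m) / 4 ^ m) * (1 + 1 / (2 * real m))"
    if "m > 0" for m
  proof -
    have s: "sqrt (real m) = exp (ln (real m) / 2)" "sqrt (real m) * sqrt (real m) = real m"
      using that by (auto simp: ln_sqrt[symmetric])
    have b: "real ((2 * m) choose m) = fact (2 * m) / (fact m * fact m)"
      using binomial_fact[of m "2*m", where 'a = real] by simp
    have "rGamma_series (1/2 :: real) m = pochhammer (1/2) m * (1/2 + real m) / (fact m * sqrt (real m))"
      by (simp add: rGamma_series_def pochhammer_Suc s(1))
    also have "\<dots> = fact (2 * m) / (4 ^ m * fact m * fact m) * ((1/2 + real m) / sqrt (real m))"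
      by (simp add: poch)
    also have "(1/2 + real m) / sqrt (real m) = sqrt (real m) * (1 + 1 / (2 * real m))"
    proof -
      have "1/2 + real m = sqrt (real m) * sqrt (real m) * (1 + 1 / (2 * real m))"
        using that unfolding s(2) by (simp add: field_simps)
      also have "\<dots> / sqrt (real m) = sqrt (real m) * (1 + 1 / (2 * real m))"
        using that by (simp only: mult.assoc) simp
      finally show ?thesis .
    qed
    finally show ?thesis unfolding b by (simp add: mult_ac)
  qed
  have "rGamma_series (1/2 :: real) \<longlonglongrightarrow> rGamma (1/2)" by (rule rGamma_series_LIMSEQ)
  also have "rGamma (1/2 :: real) = 1 / sqrt pi"
    by (simp add: rGamma_inverse_Gamma Gamma_one_half_real field_simps)
  finally have 1: "rGamma_series (1/2 :: real) \<longlonglongrightarrow> 1 / sqrt pi" .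
  have "(\<lambda>m. 1 + 1 / (2 * real m)) \<longlonglongrightarrow> 1" by real_asymp
  from tendsto_divide[OF 1 this]
  have 2: "(\<lambda>m. rGamma_series (1/2 :: real) m / (1 + 1 / (2 * real m))) \<longlonglongrightarrow> 1 / sqrt pi"
    by (simp only: div_by_1)
  have "eventually (\<lambda>m. rGamma_series (1/2 :: real) m / (1 + 1 / (2 * real m)) =
          sqrt (real m) * real ((2 * m) choose m) / 4 ^ m) sequentially"
    using eventually_gt_at_top[of "0::nat"]
  proof eventually_elim
    case (elim m)
    have "1 + 1 / (2 * real m) > 0" by (simp add: add_pos_nonneg)
    thus ?case unfolding eq[OF elim] by simp
  qed
  thus ?thesis by (rule Lim_transform_eventually[OF 2])
qed

section \<open>The theta transformation\<close>

lemma sum_cos_roots_of_unity: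
  assumes "l > 0"
  shows "(\<Sum>k<l. cos (2 * pi * real k * real r / real l)) = (if l dvd r then real l else 0)"
proof -
  define w where "w = cis (2 * pi * real r / real l)"
  have wk: "w ^ k = cis (2 * pi * real k * real r / real l)" for k
    by (simp add: w_def Complex.DeMoivre mult_ac)
  have "(\<Sum>k<l. cos (2 * pi * real k * real r / real l)) = Re (\<Sum>k<l. w ^ k)"
    by (simp add: wk)
  also have "(\<Sum>k<l. w ^ k) = (if l dvd r then of_nat l else 0)"
  proof (cases "l dvd r")
    case True
    then obtain q where "r = l * q" by auto
    hence "w = 1" using assms by (simp add: w_def cis_conv_exp exp_eq_1 mult_ac)
    thus ?thesis using True by simp
  next
    case False
    have "w \<noteq> 1"
    proof
      assume "w = 1"
      then obtain n :: int where "2 * pi * real r / real l = real_of_int n * 2 * pi"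
        by (auto simp: w_def cis_conv_exp exp_eq_1 mult_ac)
      hence "real r = real_of_int n * real l" using assms by (simp add: field_simps)
      hence "real_of_int (int r) = real_of_int (n * int l)" by simp
      hence "int r = n * int l" by (simp only: of_int_eq_iff)
      hence "int l dvd int r" by simp
      with False show False by simp
    qed
    moreover have "w ^ l = 1" 
      using assms by (simp add: wk cis_conv_exp exp_eq_1 mult_ac)
    ultimately show ?thesis using False by (simp add: geometric_sum)
  qed
  finally show ?thesis by simp
qed

lemma sum_fold_at_midpoint:
  fixes f :: "nat \<Rightarrow> real"
  shows "(\<Sum>j\<le>2*m. f j) = f m + (\<Sum>r=1..m. f (m - r) + f (m + r))"
proof -
  have "{..2*m} = {..<m} \<union> {m} \<union> {m<..2*m}" by auto
  hence "(\<Sum>j\<le>2*m. f j) = (\<Sum>j\<in>{..<m} \<union> {m}. f j) + (\<Sum>j\<in>{m<..2*m}. f j)"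
    by (simp only:) (rule sum.union_disjoint, auto)
  also have "(\<Sum>j\<in>{..<m} \<union> {m}. f j) = f m + (\<Sum>j<m. f j)"
    by (subst sum.union_disjoint) auto
  also have "(\<Sum>j<m. f j) = (\<Sum>r=1..m. f (m - r))"
    by (rule sum.reindex_bij_witness[of _ "\<lambda>r. m - r" "\<lambda>j. m - j"]) auto
  also have "(\<Sum>j\<in>{m<..2*m}. f j) = (\<Sum>r=1..m. f (m + r))"
    by (rule sum.reindex_bij_witness[of _ "\<lambda>r. m + r" "\<lambda>j. j - m"]) auto
  finally show ?thesis by (simp add: sum.distrib)
qed

lemma cos_even_power:
  "4 ^ m * cos x ^ (2 * m) =
     real ((2*m) choose m) + 2 * (\<Sum>r=1..m. real ((2*m) choose (m + r)) * cos (2 * real r * x))"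
proof -
  have "complex_of_real (4 ^ m * cos x ^ (2 * m)) = (cis x + cis (- x)) ^ (2 * m)"
  proof -
    have "cis x + cis (- x) = of_real (2 * cos x)" by (simp add: complex_eq_iff)
    thus ?thesis by (simp add: power_mult_distrib power_mult)
  qed
  also have "\<dots> = (\<Sum>j\<le>2*m. of_nat ((2*m) choose j) * cis x ^ j * cis (- x) ^ (2*m - j))"
    by (rule binomial_ring)
  also have "\<dots> = (\<Sum>j\<le>2*m. of_real (real ((2*m) choose j)) * cis ((2 * real j - 2 * real m) * x))"
    by (intro sum.cong refl) (auto simp: Complex.DeMoivre cis_mult of_nat_diff algebra_simps)
  finally have "4 ^ m * cos x ^ (2 * m) = Re \<dots>"
    by (metis Re_complex_of_real)
  also have "\<dots> = (\<Sum>j\<le>2*m. real ((2*m) choose j) * cos ((2 * real j - 2 * real m) * x))"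
    by simp
  also have "\<dots> = real ((2*m) choose m) + (\<Sum>r=1..m. 2 * (real ((2*m) choose (m + r)) * cos (2 * real r * x)))"
    unfolding sum_fold_at_midpoint
  proof (intro arg_cong2[where f = "(+)"] sum.cong refl)
    fix r assume r: "r \<in> {1..m}"
    have b: "(2*m) choose (m - r) = (2*m) choose (m + r)"
      using binomial_symmetric[of "m - r" "2*m"] r by (simp add: mult_2)
    have "(2 * real (m - r) - 2 * real m) * x = - (2 * real r * x)"
      using r by (simp add: of_nat_diff algebra_simps)
    hence c: "cos ((2 * real (m - r) - 2 * real m) * x) = cos (2 * real r * x)"
      by (simp only: cos_minus)
    show "real (2 * m choose (m - r)) * cos ((2 * real (m - r) - 2 * real m) * x) +
         real (2 * m choose (m + r)) * cos ((2 * real (m + r) - 2 * real m) * x) =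
         2 * (real (2 * m choose (m + r)) * cos (2 * real r * x))"
      unfolding b c by simp
  qed simp
  finally show ?thesis by (simp add: sum_distrib_left)
qed

text \<open>
  Polya's finite form of the theta transformation. Expand (2 cos u)^(2m) into cosines of 2ru and sum
  over u = pi k/l: orthogonality of the roots of unity keeps only the r divisible by l. The modulus
  l = 2p + 1 is odd so that k and l - k pair up without a middle term. Both sides are written as
  infinite series with finite support, the form in which Tannery's theorem applies.
\<close>
lemma discrete_theta_identity:
  fixes p m :: nat
  defines "l \<equiv> 2 * p + 1"
  shows "1 + 2 * (\<Sum>k. if k < p then cos (pi * real (Suc k) / real l) ^ (2 * m) else 0) =
         (real l * real ((2*m) choose m) / 4 ^ m) * (1 + 2 * (\<Sum>k. central_ratio m (l * Suc k)))"
proof -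
  let ?c = "\<lambda>k::nat. cos (pi * real k / real l) ^ (2 * m)"
  let ?B = "\<lambda>r. real ((2*m) choose (m + r))"
  have l: "l > 0" by (simp add: l_def)
  have "{..<l} = insert 0 ({1..p} \<union> {p<..<l})" by (auto simp: l_def)
  hence "(\<Sum>k<l. ?c k) = ?c 0 + (\<Sum>k\<in>{1..p} \<union> {p<..<l}. ?c k)"
    by (simp only:) (subst sum.insert, auto)
  also have "(\<Sum>k\<in>{1..p} \<union> {p<..<l}. ?c k) = (\<Sum>k=1..p. ?c k) + (\<Sum>k\<in>{p<..<l}. ?c k)"
    by (rule sum.union_disjoint) auto
  also have "(\<Sum>k\<in>{p<..<l}. ?c k) = (\<Sum>k=1..p. ?c k)"
  proof (rule sum.reindex_bij_witness[of _ "\<lambda>k. l - k" "\<lambda>k. l - k"])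
    fix k assume k: "k \<in> {p<..<l}"
    have "pi * real (l - k) / real l = pi - pi * real k / real l"
      using k l by (simp add: of_nat_diff right_diff_distrib diff_divide_distrib)
    hence "cos (pi * real (l - k) / real l) = - cos (pi * real k / real l)"
      by simp
    thus "?c (l - k) = ?c k" by (simp add: power_mult)
  qed (auto simp: l_def)
  also have "(\<Sum>k=1..p. ?c k) = (\<Sum>k<p. ?c (Suc k))"
    by (rule sum.reindex_bij_witness[of _ Suc "\<lambda>k. k - 1"]) auto
  also have "\<dots> = (\<Sum>k. if k < p then ?c (Suc k) else 0)"
    by (subst suminf_finite[of "{..<p}"]) auto
  finally have 1: "(\<Sum>k<l. ?c k) = 1 + 2 * (\<Sum>k. if k < p then ?c (Suc k) else 0)"
    by simp

  have "4 ^ m * (\<Sum>k<l. ?c k) =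
        (\<Sum>k<l. ?B 0 + 2 * (\<Sum>r=1..m. ?B r * cos (2 * pi * real k * real r / real l)))"
    unfolding sum_distrib_left[of "4 ^ m" _ "{..<l}"] cos_even_power
    by (intro sum.cong refl) (simp add: mult_ac)
  also have "\<dots> = real l * ?B 0 + 2 * (\<Sum>r=1..m. ?B r * (\<Sum>k<l. cos (2 * pi * real k * real r / real l)))"
    by (simp add: sum.distrib sum_distrib_left sum.swap[of _ "{..<l}"])
  also have "\<dots> = real l * ?B 0 + 2 * (\<Sum>r=1..m. if l dvd r then real l * ?B r else 0)"
    unfolding sum_cos_roots_of_unity[OF l]
    by (intro arg_cong2[where f = "(+)"] arg_cong2[where f = "(*)"] sum.cong refl) auto
  also have "(\<Sum>r=1..m. if l dvd r then real l * ?B r else 0) = (\<Sum>k<m. real l * ?B (l * Suc k))"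
  proof -
    have "(\<Sum>r=1..m. if l dvd r then real l * ?B r else 0) = (\<Sum>r | r \<in> {1..m} \<and> l dvd r. real l * ?B r)"
      by (rule sum.inter_filter[symmetric]) simp
    also have "\<dots> = (\<Sum>k | k < m \<and> l * Suc k \<le> m. real l * ?B (l * Suc k))"
    proof (rule sum.reindex_bij_witness[of _ "\<lambda>k. l * Suc k" "\<lambda>r. r div l - 1"])
      fix r assume r: "r \<in> {r. r \<in> {1..m} \<and> l dvd r}"
      then obtain q where q: "r = l * q" by auto
      have "q > 0" using r q by (cases q) auto
      moreover have "q \<le> m" using r q l by (metis (mono_tags, lifting) One_nat_def Suc_leI atLeastAtMost_iff dvd_triv_right mem_Collect_eq dvd_imp_le le_trans neq0_conv not_one_le_zero)
      ultimately show eq: "l * Suc (r div l - 1) = r" and "r div l - 1 \<in> {k. k < m \<and> l * Suc k \<le> m}"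
        using r q l by (simp_all del: mult_Suc_right)
      show "real l * ?B (l * Suc (r div l - 1)) = real l * ?B r"
        using q l \<open>q > 0\<close> by simp
    next
      fix k assume "k \<in> {k. k < m \<and> l * Suc k \<le> m}"
      thus "l * Suc k div l - 1 = k" "l * Suc k \<in> {r. r \<in> {1..m} \<and> l dvd r}" using l by auto
    qed
    also have "\<dots> = (\<Sum>k<m. real l * ?B (l * Suc k))"
      by (rule sum.mono_neutral_left) (auto simp: not_le)
    finally show ?thesis .
  qed
  also have "\<dots> = real l * (\<Sum>k. ?B (l * Suc k))"
  proof -
    have "(\<Sum>k. ?B (l * Suc k)) = (\<Sum>k<m. ?B (l * Suc k))"
    proof (rule suminf_finite)
      fix k assume "k \<notin> {..<m}"
      hence "m < 1 * Suc k" by simp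
      also have "\<dots> \<le> l * Suc k" using l by (intro mult_right_mono) auto
      finally show "?B (l * Suc k) = 0" by simp
    qed simp
    thus ?thesis by (simp add: sum_distrib_left)
  qed
  also have "(\<Sum>k. ?B (l * Suc k)) = ?B 0 * (\<Sum>k. central_ratio m (l * Suc k))"
  proof -
    have "summable (\<lambda>k. central_ratio m (l * Suc k))"
    proof (rule summable_finite[of "{..<m}"])
      fix k assume "k \<notin> {..<m}"
      hence "m < 1 * Suc k" by simp
      also have "\<dots> \<le> l * Suc k" using l by (intro mult_right_mono) auto
      finally show "central_ratio m (l * Suc k) = 0" by (rule central_ratio_eq_0)
    qed simp
    hence "?B 0 * (\<Sum>k. central_ratio m (l * Suc k)) = (\<Sum>k. ?B 0 * central_ratio m (l * Suc k))"
      by (rule suminf_mult[symmetric])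
    thus ?thesis by (simp add: central_ratio_def)
  qed
  finally have "(\<Sum>k<l. ?c k) =
      (real l * ?B 0 + 2 * (real l * (?B 0 * (\<Sum>k. central_ratio m (l * Suc k))))) / 4 ^ m"
    by (simp add: eq_divide_eq mult_ac)
  also have "\<dots> = (real l * ?B 0 / 4 ^ m) * (1 + 2 * (\<Sum>k. central_ratio m (l * Suc k)))"
    by (simp add: algebra_simps add_divide_distrib)
  finally show ?thesis using 1 by simp
qed

text \<open>
  Jacobi's theta function on the positive imaginary axis is 1 + 2 \<open>theta_tail\<close>; the constant term
  is split off because its Mellin integral diverges.
\<close>
definition theta_tail :: "real \<Rightarrow> real" where
  "theta_tail x = (\<Sum>k. exp (- (pi * real (Suc k) ^ 2 * x)))"

lemma exp_neg_square_le_geometric: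
  fixes c :: real
  assumes "c \<ge> 0"
  shows "exp (- (c * real (Suc k) ^ 2)) \<le> exp (- c) ^ Suc k"
proof -
  have "exp (- c) ^ Suc k = exp (- (c * real (Suc k)))"
    by (simp only: exp_of_nat_mult[symmetric]) (simp add: mult_ac)
  moreover have "c * real (Suc k) * 1 \<le> c * real (Suc k) * real (Suc k)"
    using assms by (intro mult_left_mono) auto
  ultimately show ?thesis by (simp add: power2_eq_square mult_ac)
qed

lemma summable_geometric_exp:
  fixes c :: real assumes "c > 0" shows "summable (\<lambda>k. exp (- c) ^ Suc k)"
  by (subst summable_Suc_iff) (use assms in \<open>auto intro!: summable_geometric\<close>)

text \<open>
  The limit of the discrete identity with m/l^2 tending to t = x/pi: then cos (pi k/l)^(2m) tends to
  exp (- pi k^2 x), the ratio at distance lk from the centre tends to exp (- pi k^2/x), and the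
  prefactor l binomial(2m,m)/4^m tends to 1/sqrt (pi t) = 1/sqrt x.
\<close>
lemma theta_tail_reciprocal:
  assumes x: "x > 0"
  shows "1 + 2 * theta_tail x = (1 + 2 * theta_tail (1 / x)) / sqrt x"
proof -
  define t where "t = x / pi"
  have t: "t > 0" using x by (simp add: t_def)
  define l where "l = (\<lambda>p::nat. 2 * p + 1)"
  \<comment> \<open>Rounding up ensures m >= t l^2, hence a geometric majorant with a ratio independent of p.\<close>
  define m where "m = (\<lambda>p. nat \<lceil>t * real (l p) ^ 2\<rceil>)"
  have lpos: "real (l p) \<ge> 1" "l p > 0" for p by (auto simp: l_def)
  have m_ge: "t * real (l p) ^ 2 \<le> real (m p)" for p
    unfolding m_def by linarith
  have m_le: "real (m p) \<le> t * real (l p) ^ 2 + 1" for p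
  proof -
    have "0 \<le> t * real (l p) ^ 2" using t by simp
    thus ?thesis unfolding m_def by linarith
  qed
  have inv_l: "(\<lambda>p. 1 / real (l p) ^ 2) \<longlonglongrightarrow> 0"
    unfolding l_def by real_asymp
  have mpos: "m p > 0" for p
    using m_ge[of p] t lpos[of p] by (smt (verit) mult_pos_pos of_nat_0_less_iff zero_less_power)
  have m_l: "(\<lambda>p. real (m p) / real (l p) ^ 2) \<longlonglongrightarrow> t"
  proof (rule tendsto_sandwich)
    show "\<forall>\<^sub>F p in sequentially. t \<le> real (m p) / real (l p) ^ 2"
      using m_ge lpos by (auto simp: field_simps)
    have "real (m p) / real (l p) ^ 2 \<le> t + 1 / real (l p) ^ 2" for p
      using m_le[of p] lpos[of p] by (simp add: field_simps)
    thus "\<forall>\<^sub>F p in sequentially. real (m p) / real (l p) ^ 2 \<le> t + 1 / real (l p) ^ 2" by simp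
    show "(\<lambda>p. t + 1 / real (l p) ^ 2) \<longlonglongrightarrow> t"
      using tendsto_add[OF tendsto_const inv_l, of t] by simp
  qed simp
  have m_at_top: "filterlim m at_top sequentially"
  proof -
    have "filterlim (\<lambda>p. t * real (l p) ^ 2) at_top sequentially"
      using t unfolding l_def by real_asymp
    hence "filterlim (\<lambda>p. real (m p)) at_top sequentially"
      by (rule filterlim_at_top_mono) (use m_ge in auto)
    thus ?thesis by (simp add: filterlim_sequentially_iff_filterlim_real)
  qed

  define a where "a = (\<lambda>k p. if k < p then cos (pi * real (Suc k) / real (l p)) ^ (2 * m p) else 0)"
  have a_lim: "(\<lambda>p. a k p) \<longlonglongrightarrow> exp (- (pi * real (Suc k) ^ 2 * x))" for k
  proof -
    define s where "s = (\<lambda>p. sin (pi * real (Suc k) / real (l p)) ^ 2)"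
    have s0: "s \<longlonglongrightarrow> 0"
      unfolding s_def l_def by real_asymp
    \<comment> \<open>That is, l^2 sin^2 (c/l) tends to c^2.\<close>
    have "(\<lambda>p. real (2 * p + 1) ^ 2 * sin (c / real (2 * p + 1)) ^ 2) \<longlonglongrightarrow> c ^ 2"
      if "c > 0" for c
    proof -
      have "((\<lambda>y. (sin (c * y) / y) ^ 2) \<longlongrightarrow> c ^ 2) (at_right 0)"
        using that by real_asymp
      moreover have "filterlim (\<lambda>p. 1 / real (2 * p + 1)) (at_right 0) sequentially"
        by real_asymp
      ultimately have "(\<lambda>p. (sin (c * (1 / real (2 * p + 1))) / (1 / real (2 * p + 1))) ^ 2) \<longlonglongrightarrow> c ^ 2"
        by (rule filterlim_compose)
      thus ?thesis by (simp add: power_mult_distrib mult.commute)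
    qed
    moreover have "pi * real (Suc k) > 0" by simp
    ultimately have "(\<lambda>p. real (l p) ^ 2 * s p) \<longlonglongrightarrow> (pi * real (Suc k)) ^ 2"
      unfolding s_def l_def by blast
    from tendsto_mult[OF m_l this]
    have "(\<lambda>p. real (m p) * s p) \<longlonglongrightarrow> t * (pi * real (Suc k)) ^ 2"
      using lpos(2) by (simp add: less_imp_neq[THEN not_sym])
    hence "(\<lambda>p. (1 - s p) ^ m p) \<longlonglongrightarrow> exp (- (t * (pi * real (Suc k)) ^ 2))"
      by (intro power_one_minus_tendsto_exp s0)
    moreover have "t * (pi * real (Suc k)) ^ 2 = pi * real (Suc k) ^ 2 * x"
      by (simp add: t_def power2_eq_square)
    ultimately have "(\<lambda>p. (1 - s p) ^ m p) \<longlonglongrightarrow> exp (- (pi * real (Suc k) ^ 2 * x))" by simp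
    moreover have "eventually (\<lambda>p. (1 - s p) ^ m p = a k p) sequentially"
      using eventually_gt_at_top[of k]
      by eventually_elim (simp add: a_def s_def cos_squared_eq power_mult)
    ultimately show ?thesis by (rule Lim_transform_eventually)
  qed
  have a_bound: "norm (a k p) \<le> exp (- (pi\<^sup>2 * t)) ^ Suc k" for k p
  proof (cases "k < p")
    case True
    define u where "u = pi * real (Suc k) / real (l p)"
    have "real (Suc k) / real (l p) \<le> 1 / 2"
      using True by (simp add: l_def field_simps)
    hence "pi * (real (Suc k) / real (l p)) \<le> pi * (1 / 2)"
      by (intro mult_left_mono) auto
    hence u: "0 \<le> u" "u \<le> pi / 2"
      by (auto simp: u_def)
    have "real (2 * m p) * - (u\<^sup>2 / 2) = - (real (m p) * u\<^sup>2)" by simp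
    also have "\<dots> \<le> - (t * real (l p) ^ 2 * u\<^sup>2)"
      using m_ge[of p] by (intro le_imp_neg_le mult_right_mono) auto
    also have "\<dots> = - (pi\<^sup>2 * t * real (Suc k) ^ 2)"
      using lpos(2)[of p] by (simp add: u_def power_divide power_mult_distrib)
    finally have le: "real (2 * m p) * - (u\<^sup>2 / 2) \<le> - (pi\<^sup>2 * t * real (Suc k) ^ 2)" .
    have c: "0 \<le> cos u" using u by (intro cos_ge_zero) auto
    have "norm (a k p) = cos u ^ (2 * m p)" using True c by (simp add: a_def u_def)
    also have "\<dots> \<le> exp (- (u\<^sup>2 / 2)) ^ (2 * m p)"
      using c cos_le_exp_neg_square[OF u] by (intro power_mono)
    also have "\<dots> = exp (real (2 * m p) * - (u\<^sup>2 / 2))"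
      by (simp only: exp_of_nat_mult)
    also have "\<dots> \<le> exp (- (pi\<^sup>2 * t * real (Suc k) ^ 2))" using le by simp
    also have "\<dots> \<le> exp (- (pi\<^sup>2 * t)) ^ Suc k"
      using t by (intro exp_neg_square_le_geometric) auto
    finally show ?thesis .
  qed (simp add: a_def)
  have "(\<lambda>p. \<Sum>k. a k p) \<longlonglongrightarrow> (\<Sum>k. exp (- (pi * real (Suc k) ^ 2 * x)))"
  proof (rule conjunct2[OF conjunct2[OF tannerys_theorem]])
    show "\<forall>\<^sub>F (k, p) in at_top \<times>\<^sub>F sequentially. norm (a k p) \<le> exp (- (pi\<^sup>2 * t)) ^ Suc k"
      using a_bound by (intro always_eventually) auto
    show "summable (\<lambda>k. exp (- (pi\<^sup>2 * t)) ^ Suc k)"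
      using t by (intro summable_geometric_exp) auto
  qed (use a_lim in auto)
  hence lhs: "(\<lambda>p. 1 + 2 * (\<Sum>k. a k p)) \<longlonglongrightarrow> 1 + 2 * theta_tail x"
    unfolding theta_tail_def by (intro tendsto_intros)

  define b where "b = (\<lambda>k p. central_ratio (m p) (l p * Suc k))"
  have b_lim: "(\<lambda>p. b k p) \<longlonglongrightarrow> exp (- (pi * real (Suc k) ^ 2 * (1 / x)))" for k
    unfolding b_def
  proof (rule central_ratio_tendsto[OF m_at_top])
    have "(\<lambda>p. real (Suc k) ^ 2 / (real (m p) / real (l p) ^ 2)) \<longlonglongrightarrow> real (Suc k) ^ 2 / t"
      using t by (intro tendsto_intros m_l) auto
    moreover have "real (Suc k) ^ 2 / (real (m p) / real (l p) ^ 2) = real (l p * Suc k) ^ 2 / real (m p)" for p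
      unfolding of_nat_mult power_mult_distrib by simp
    moreover have "real (Suc k) ^ 2 / t = pi * real (Suc k) ^ 2 * (1 / x)"
      by (simp add: t_def)
    ultimately show "(\<lambda>p. real (l p * Suc k) ^ 2 / real (m p)) \<longlonglongrightarrow> pi * real (Suc k) ^ 2 * (1 / x)"
      by (simp only:)
  qed
  have b_bound: "norm (b k p) \<le> exp (- (1 / (2 * (t + 1)))) ^ Suc k" for k p
  proof -
    have "1 \<le> real (l p) ^ 2" using lpos(1)[of p] by simp
    hence "real (m p) \<le> (t + 1) * real (l p) ^ 2"
      using m_le[of p] by (simp add: algebra_simps)
    hence "real (l p * Suc k) ^ 2 / (2 * ((t + 1) * real (l p) ^ 2)) \<le> real (l p * Suc k) ^ 2 / (2 * real (m p))"
      using mpos[of p] t lpos(2)[of p] by (intro divide_left_mono) auto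
    also have "real (l p * Suc k) ^ 2 / (2 * ((t + 1) * real (l p) ^ 2)) = 1 / (2 * (t + 1)) * real (Suc k) ^ 2"
      using lpos(2)[of p] unfolding of_nat_mult power_mult_distrib by simp
    finally have le: "- (real (l p * Suc k) ^ 2 / (2 * real (m p))) \<le> - (1 / (2 * (t + 1)) * real (Suc k) ^ 2)"
      by simp
    have "norm (b k p) = central_ratio (m p) (l p * Suc k)"
      by (simp add: b_def central_ratio_nonneg del: mult_Suc_right)
    also have "\<dots> \<le> exp (- (real (l p * Suc k) ^ 2 / (2 * real (m p))))"
      by (rule central_ratio_le_exp)
    also have "\<dots> \<le> exp (- (1 / (2 * (t + 1)) * real (Suc k) ^ 2))" using le by (simp only: exp_le_cancel_iff)
    also have "\<dots> \<le> exp (- (1 / (2 * (t + 1)))) ^ Suc k"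
      using t by (intro exp_neg_square_le_geometric) auto
    finally show ?thesis .
  qed
  have b_sum: "(\<lambda>p. \<Sum>k. b k p) \<longlonglongrightarrow> (\<Sum>k. exp (- (pi * real (Suc k) ^ 2 * (1 / x))))"
  proof (rule conjunct2[OF conjunct2[OF tannerys_theorem]])
    show "\<forall>\<^sub>F (k, p) in at_top \<times>\<^sub>F sequentially. norm (b k p) \<le> exp (- (1 / (2 * (t + 1)))) ^ Suc k"
      using b_bound by (intro always_eventually) auto
    show "summable (\<lambda>k. exp (- (1 / (2 * (t + 1)))) ^ Suc k)"
      using t by (intro summable_geometric_exp) auto
  qed (use b_lim in auto)

  have const: "(\<lambda>p. real (l p) * real ((2 * m p) choose m p) / 4 ^ m p) \<longlonglongrightarrow> 1 / sqrt x"
  proof -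
    have "(\<lambda>p. sqrt (real (m p)) * real ((2 * m p) choose m p) / 4 ^ m p) \<longlonglongrightarrow> 1 / sqrt pi"
      by (rule filterlim_compose[OF central_binomial_tendsto m_at_top])
    moreover have "(\<lambda>p. sqrt (real (m p) / real (l p) ^ 2)) \<longlonglongrightarrow> sqrt t"
      by (intro tendsto_intros m_l)
    ultimately have "(\<lambda>p. (sqrt (real (m p)) * real ((2 * m p) choose m p) / 4 ^ m p) / sqrt (real (m p) / real (l p) ^ 2)) \<longlonglongrightarrow> (1 / sqrt pi) / sqrt t"
      by (rule tendsto_divide) (use t in simp)
    moreover have "(sqrt (real (m p)) * real ((2 * m p) choose m p) / 4 ^ m p) / sqrt (real (m p) / real (l p) ^ 2) = real (l p) * real ((2 * m p) choose m p) / 4 ^ m p" for p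
      using mpos[of p] lpos(2)[of p] by (simp add: real_sqrt_divide)
    moreover have "(1 / sqrt pi) / sqrt t = 1 / sqrt x"
      by (simp add: t_def real_sqrt_divide)
    ultimately show ?thesis by simp
  qed
  have "(\<lambda>p. (real (l p) * real ((2 * m p) choose m p) / 4 ^ m p) * (1 + 2 * (\<Sum>k. b k p)))
          \<longlonglongrightarrow> 1 / sqrt x * (1 + 2 * theta_tail (1 / x))"
    unfolding theta_tail_def by (intro tendsto_intros const b_sum)
  moreover have "1 + 2 * (\<Sum>k. a k p) = (real (l p) * real ((2 * m p) choose m p) / 4 ^ m p) * (1 + 2 * (\<Sum>k. b k p))" for p
    unfolding a_def b_def l_def by (rule discrete_theta_identity)
  ultimately have "(\<lambda>p. 1 + 2 * (\<Sum>k. a k p)) \<longlonglongrightarrow> 1 / sqrt x * (1 + 2 * theta_tail (1 / x))"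
    by simp
  with lhs have "1 + 2 * theta_tail x = 1 / sqrt x * (1 + 2 * theta_tail (1 / x))"
    by (rule LIMSEQ_unique)
  thus ?thesis by simp
qed

section \<open>Mellin integrals\<close>

text \<open>
  Carries termwise integration over from the Lebesgue integral to gauge integrals over a set, in
  whose terms the Gamma integral and the substitution rule are stated.
\<close>
lemma integral_suminf_on:
  fixes f :: "nat \<Rightarrow> real \<Rightarrow> complex"
  assumes f: "\<And>n. f n absolutely_integrable_on S"
    and s: "\<And>x. x \<in> S \<Longrightarrow> summable (\<lambda>n. norm (f n x))"
    and t: "summable (\<lambda>n. integral S (\<lambda>x. norm (f n x)))"
  shows "(\<lambda>x. \<Sum>n. f n x) absolutely_integrable_on S"
    and "(\<lambda>n. integral S (f n)) sums integral S (\<lambda>x. \<Sum>n. f n x)"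
proof -
  let ?g = "\<lambda>n x. indicat_real S x *\<^sub>R f n x"
  have g: "integrable lebesgue (?g n)" for n
    using f[of n] unfolding set_integrable_def .
  have "summable (\<lambda>n. norm (?g n x))" for x
    using s[of x] by (cases "x \<in> S") auto
  hence ae: "AE x in lebesgue. summable (\<lambda>n. norm (?g n x))" by simp
  have "(LINT x|lebesgue. norm (?g n x)) = integral S (\<lambda>x. norm (f n x))" for n
  proof -
    have "(\<lambda>x. norm (f n x)) absolutely_integrable_on S"
      using absolutely_integrable_norm[OF f[of n]] by (simp add: o_def)
    from set_lebesgue_integral_eq_integral(2)[OF this] show ?thesis
      by (simp add: set_lebesgue_integral_def)
  qed
  hence sm: "summable (\<lambda>n. LINT x|lebesgue. norm (?g n x))" using t by simp
  have sg: "(\<Sum>n. ?g n x) = indicat_real S x *\<^sub>R (\<Sum>n. f n x)" for x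
    by (cases "x \<in> S") auto
  show 1: "(\<lambda>x. \<Sum>n. f n x) absolutely_integrable_on S"
    using integrable_suminf[OF g ae sm] unfolding set_integrable_def sg .
  have "(\<lambda>n. LINT x|lebesgue. ?g n x) sums (LINT x|lebesgue. (\<Sum>n. ?g n x))"
    by (rule sums_integral[OF g ae sm])
  thus "(\<lambda>n. integral S (f n)) sums integral S (\<lambda>x. \<Sum>n. f n x)"
    using set_lebesgue_integral_eq_integral(2)[OF f] set_lebesgue_integral_eq_integral(2)[OF 1]
    unfolding sg by (simp add: set_lebesgue_integral_def)
qed

lemma Gamma_integral_scaled:
  fixes a :: complex and c :: real
  assumes a: "Re a > 0" and c: "c > 0"
  shows "(\<lambda>x. of_real (exp (- (c * x))) * of_real x powr (a - 1)) absolutely_integrable_on {0<..}"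
    and "integral {0<..} (\<lambda>x. of_real (exp (- (c * x))) * of_real x powr (a - 1)) = Gamma a * of_real c powr (- a)"
proof -
  let ?f = "\<lambda>t. complex_of_real t powr (a - 1) / of_real (exp t)"
  let ?G = "\<lambda>x. complex_of_real (exp (- (c * x))) * of_real x powr (a - 1)"
  have img: "(\<lambda>x. c * x) ` {0<..} = {0<..}"
  proof (intro equalityI subsetI)
    fix y :: real assume "y \<in> {0<..}"
    thus "y \<in> (\<lambda>x. c * x) ` {0<..}"
      using c by (intro image_eqI[of _ _ "y / c"]) auto
  qed (use c in auto)
  have "?f absolutely_integrable_on {0<..} \<and> integral {0<..} ?f = Gamma a"
    using absolutely_integrable_Gamma_integral'[OF a] integral_unique[OF Gamma_integral_complex'[OF a]] by simp
  hence *: "(\<lambda>x. \<bar>c\<bar> *\<^sub>R ?f (c * x)) absolutely_integrable_on {0<..} \<and>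
         integral {0<..} (\<lambda>x. \<bar>c\<bar> *\<^sub>R ?f (c * x)) = Gamma a"
    using has_absolute_integral_change_of_variables_real[of "{0<..}" "\<lambda>x. c * x" "\<lambda>_. c" ?f "Gamma a"] c
    unfolding img by (auto simp: inj_on_def intro!: derivative_eq_intros)
  have eq: "\<bar>c\<bar> *\<^sub>R ?f (c * x) = of_real c powr a * ?G x" if "x \<in> {0<..}" for x
  proof -
    have "of_real c powr a = of_real c powr (a - 1) * (of_real c :: complex)"
      using c by (simp add: powr_diff)
    thus ?thesis using c that
      by (simp add: powr_times_real scaleR_conv_of_real exp_minus exp_of_real field_simps)
  qed
  have cnz: "of_real c powr a \<noteq> (0 :: complex)" using c by simp
  have "(\<lambda>x. of_real c powr a * ?G x) absolutely_integrable_on {0<..}"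
    using * by (subst set_integrable_cong[OF refl refl eq[symmetric]]) auto
  thus 1: "?G absolutely_integrable_on {0<..}"
    using cnz by (simp add: set_integrable_mult_right_iff)
  have "of_real c powr a * integral {0<..} ?G = integral {0<..} (\<lambda>x. of_real c powr a * ?G x)"
    by (rule integral_mult_right[symmetric])
  also have "\<dots> = integral {0<..} (\<lambda>x. \<bar>c\<bar> *\<^sub>R ?f (c * x))"
    by (rule integral_cong) (use eq in simp)
  also have "\<dots> = Gamma a" using * by simp
  finally show "integral {0<..} ?G = Gamma a * of_real c powr (- a)"
    using cnz by (simp add: powr_minus field_simps)
qed

text \<open>
  Absolute integrability turns the improper integral into a limit over [1,y], where the fundamental
  theorem of calculus applies to the antiderivative F.
\<close>
lemma integral_complex_powr_to_inf:
  fixes b :: complex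
  assumes b: "Re b > 0"
  shows "(\<lambda>x. of_real x powr (- b - 1)) absolutely_integrable_on {1..}"
    and "integral {1..} (\<lambda>x. of_real x powr (- b - 1)) = 1 / b"
proof -
  let ?f = "\<lambda>x. complex_of_real x powr (- b - 1)"
  define F where "F = (\<lambda>x. - (complex_of_real x powr (- b)) / b)"
  have bnz: "b \<noteq> 0" using b by auto
  have deriv: "(F has_vector_derivative ?f x) (at x within A)" if "x > 0" for x A
  proof -
    have "((\<lambda>z. - (z powr (- b)) / b) has_field_derivative of_real x powr (- b - 1)) (at (of_real x))"
      using that bnz by (auto intro!: derivative_eq_intros)
    from has_vector_derivative_real_field[OF this] show ?thesis
      unfolding F_def by (rule has_vector_derivative_at_within)
  qed
  have cont: "continuous_on {1..} ?f"
    by (intro continuous_intros) auto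
  have lim0: "((\<lambda>x. x powr (- Re b)) \<longlongrightarrow> 0) at_top"
    using b by real_asymp
  show int: "?f absolutely_integrable_on {1..}"
  proof (rule measurable_bounded_by_integrable_imp_absolutely_integrable)
    show "?f \<in> borel_measurable (lebesgue_on {1..})"
      using cont by (intro continuous_imp_measurable_on_sets_lebesgue) auto
    show "(\<lambda>x. x powr (- Re b - 1)) integrable_on {1..}"
      using has_integral_powr_to_inf[of "- Re b - 1" 1] b by (auto simp: integrable_on_def)
  qed (auto simp: norm_powr_real_powr)
  have limF: "((\<lambda>y. F y - F 1) \<longlongrightarrow> 0 - F 1) at_top"
  proof (intro tendsto_intros)
    have "((\<lambda>x. x powr (- Re b) / norm b) \<longlongrightarrow> 0) at_top"
      using tendsto_divide[OF lim0 tendsto_const, of "norm b"] bnz by simp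
    moreover have "\<forall>\<^sub>F x in at_top. norm (F x) = x powr (- Re b) / norm b"
      using eventually_ge_at_top[of 0]
      by eventually_elim (simp add: F_def norm_divide norm_powr_real_powr)
    ultimately show "(F \<longlongrightarrow> 0) at_top"
      by (subst tendsto_norm_zero_iff[symmetric]) (simp add: filterlim_cong)
  qed
  have limI: "((\<lambda>y. set_lebesgue_integral lebesgue {1..y} ?f) \<longlongrightarrow> set_lebesgue_integral lebesgue {1..} ?f) at_top"
    by (rule tendsto_set_lebesgue_integral_at_top) (use int in auto)
  have "\<forall>\<^sub>F y in at_top. set_lebesgue_integral lebesgue {1..y} ?f = F y - F 1"
    using eventually_ge_at_top[of 1]
  proof eventually_elim
    case (elim y)
    have "?f absolutely_integrable_on {1..y}"
      by (rule set_integrable_subset[OF int]) auto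
    hence "set_lebesgue_integral lebesgue {1..y} ?f = integral {1..y} ?f"
      by (rule set_lebesgue_integral_eq_integral)
    also have "\<dots> = F y - F 1"
      using elim by (intro integral_unique fundamental_theorem_of_calculus deriv) auto
    finally show ?case .
  qed
  from Lim_transform_eventually[OF limI this]
  have "set_lebesgue_integral lebesgue {1..} ?f = 0 - F 1"
    by (rule tendsto_unique[OF trivial_limit_at_top_linorder _ limF])
  thus "integral {1..} ?f = 1 / b"
    using set_lebesgue_integral_eq_integral(2)[OF int] by (simp add: F_def)
qed

text \<open>
  Entire dependence on the exponent without differentiating under the integral: expanding
  x^(a-1) = exp ((a - 1) ln x) gives a power series in a - 1 whose coefficients are the moments of
  (ln x)^n/n!. The majorant of all partial sums is x^r with r = |a - 1|, and on [1,oo) the logarithm is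
  nonnegative, so integrability of g(x) x^r for every r is exactly what termwise integration needs.
\<close>
lemma mellin_tail_holomorphic:
  fixes g :: "real \<Rightarrow> real"
  assumes nonneg: "\<And>x. x \<ge> 1 \<Longrightarrow> g x \<ge> 0"
    and int: "\<And>r. (\<lambda>x. g x * x powr r) absolutely_integrable_on {1..}"
  shows "(\<lambda>a. integral {1..} (\<lambda>x. of_real (g x) * of_real x powr (a - 1))) holomorphic_on UNIV"
proof -
  define c where "c = (\<lambda>n. integral {1..} (\<lambda>x. complex_of_real (g x * ln x ^ n / fact n)))"
  let ?F = "\<lambda>a. integral {1..} (\<lambda>x. complex_of_real (g x) * of_real x powr (a - 1))"
  have g_meas: "g \<in> borel_measurable (lebesgue_on {1..})"
  proof -
    have "(\<lambda>x. g x * x powr 0) \<in> borel_measurable (lebesgue_on {1..})"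
      using int[of 0] by (subst (asm) absolutely_integrable_measurable) auto
    thus ?thesis
      by (subst measurable_cong[where g = "\<lambda>x. g x * x powr 0"]) auto
  qed
  have "(\<lambda>n. c n * (a - 1) ^ n) sums ?F a" for a
  proof -
    define r where "r = norm (a - 1)"
    let ?f = "\<lambda>n x. complex_of_real (g x * ln x ^ n / fact n) * (a - 1) ^ n"
    have nf: "norm (?f n x) = g x * ((ln x * r) ^ n / fact n)" if "x \<ge> 1" for n x
      using that nonneg[OF that] by (simp add: norm_mult norm_power norm_divide r_def power_mult_distrib)
    have nsums: "(\<lambda>n. norm (?f n x)) sums (g x * x powr r)" if x: "x \<in> {1..}" for x
    proof -
      have "(\<lambda>n. (ln x * r) ^ n / fact n) sums exp (ln x * r)"
        using exp_converges[of "ln x * r"] by (simp add: scaleR_conv_of_real divide_inverse mult.commute)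
      from sums_mult[OF this, of "g x"] show ?thesis
        using x nf by (simp add: powr_def mult.commute)
    qed
    have part: "(\<Sum>i<n. norm (?f i x)) \<le> g x * x powr r" if "x \<in> {1..}" for n x
      using sum_le_suminf[OF sums_summable[OF nsums[OF that]], of "{..<n}"] sums_unique[OF nsums[OF that]]
      by simp
    have f_int: "?f n absolutely_integrable_on {1..}" for n
    proof (rule measurable_bounded_by_integrable_imp_absolutely_integrable)
      show "?f n \<in> borel_measurable (lebesgue_on {1..})"
      proof -
        have [measurable]: "ln \<in> borel_measurable (lebesgue_on {1::real..})"
          by (intro continuous_imp_measurable_on_sets_lebesgue continuous_intros) auto
        note g_meas[measurable]
        show ?thesis by measurable
      qed
      show "(\<lambda>x. g x * x powr r) integrable_on {1..}"
        using int by (rule set_lebesgue_integral_eq_integral)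
      show "norm (?f n x) \<le> g x * x powr r" if "x \<in> {1..}" for x
      proof -
        have "norm (?f n x) \<le> (\<Sum>i<Suc n. norm (?f i x))"
          by (rule member_le_sum) auto
        also have "\<dots> \<le> g x * x powr r" by (rule part[OF that])
        finally show ?thesis .
      qed
    qed auto
    have nf_int: "(\<lambda>x. norm (?f n x)) integrable_on {1..}" for n
      using absolutely_integrable_norm[OF f_int[of n]] by (simp add: o_def set_lebesgue_integral_eq_integral(1))
    have "summable (\<lambda>n. integral {1..} (\<lambda>x. norm (?f n x)))"
    proof (rule summableI_nonneg_bounded)
      show "0 \<le> integral {1..} (\<lambda>x. norm (?f n x))" for n
        by (intro integral_nonneg nf_int) auto
      show "(\<Sum>i<n. integral {1..} (\<lambda>x. norm (?f i x))) \<le> integral {1..} (\<lambda>x. g x * x powr r)" for n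
      proof -
        have "(\<Sum>i<n. integral {1..} (\<lambda>x. norm (?f i x))) = integral {1..} (\<lambda>x. \<Sum>i<n. norm (?f i x))"
          by (intro integral_sum[symmetric] finite_lessThan nf_int)
        also have "\<dots> \<le> integral {1..} (\<lambda>x. g x * x powr r)"
          using part int nf_int
          by (intro integral_le integrable_sum finite_lessThan set_lebesgue_integral_eq_integral(1)[OF int]) blast+
        finally show ?thesis .
      qed
    qed
    from integral_suminf_on(2)[OF f_int sums_summable[OF nsums] this]
    have "(\<lambda>n. integral {1..} (?f n)) sums integral {1..} (\<lambda>x. \<Sum>n. ?f n x)" by simp
    moreover have "integral {1..} (\<lambda>x. \<Sum>n. ?f n x) = ?F a"
    proof (rule integral_cong)
      fix x :: real assume x: "x \<in> {1..}"
      have "(\<lambda>n. (of_real (ln x) * (a - 1)) ^ n / fact n) sums exp (of_real (ln x) * (a - 1))"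
        using exp_converges[of "of_real (ln x) * (a - 1)"]
        by (simp add: scaleR_conv_of_real divide_inverse mult.commute)
      from sums_mult[OF this, of "of_real (g x)"]
      have "(\<lambda>n. ?f n x) sums (of_real (g x) * exp (of_real (ln x) * (a - 1)))"
        by (simp add: power_mult_distrib mult_ac)
      thus "(\<Sum>n. ?f n x) = of_real (g x) * of_real x powr (a - 1)"
        using x by (simp add: sums_iff powr_def Ln_of_real mult.commute)
    qed
    moreover have "integral {1..} (?f n) = c n * (a - 1) ^ n" for n
      unfolding c_def by (rule integral_mult_left)
    ultimately show ?thesis by simp
  qed
  hence "?F holomorphic_on ball 1 R" for R
    by (intro power_series_holomorphic[of 1 R c]) auto
  hence "?F field_differentiable at a" for a
    using holomorphic_on_imp_differentiable_at[of ?F "ball 1 (dist 1 a + 1)" a] by auto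
  thus ?thesis
    by (auto simp: holomorphic_on_def field_differentiable_at_within)
qed

section \<open>Analytic continuation of zeta and reality of Xi\<close>

lemma theta_tail_sums:
  assumes "x > 0"
  shows "(\<lambda>k. exp (- (pi * real (Suc k) ^ 2 * x))) sums theta_tail x"
proof -
  have "norm (exp (- (pi * real (Suc k) ^ 2 * x))) \<le> exp (- (pi * x)) ^ Suc k" for k
    using exp_neg_square_le_geometric[of "pi * x" k] assms by (simp add: mult_ac)
  hence "summable (\<lambda>k. exp (- (pi * real (Suc k) ^ 2 * x)))"
    using assms by (intro summable_comparison_test'[OF summable_geometric_exp[of "pi * x"]]) auto
  thus ?thesis unfolding theta_tail_def by (rule summable_sums)
qed

lemma theta_tail_nonneg: "x > 0 \<Longrightarrow> 0 \<le> theta_tail x"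
  by (rule sums_le[OF _ sums_zero theta_tail_sums]) simp_all

text \<open>
  Each exponential contributes a scaled Gamma integral. The integrals of the norms are the same
  Gamma integrals with Re a in place of a, and sum like the Dirichlet series at 2 Re a > 1.
\<close>
lemma theta_tail_mellin:
  fixes a :: complex
  assumes a: "Re a > 1/2"
  shows "(\<lambda>x. of_real (theta_tail x) * of_real x powr (a - 1)) absolutely_integrable_on {0<..}"
    and "(\<lambda>k. Gamma a * of_real pi powr (- a) * (1 / of_nat (Suc k) powr (2 * a))) sums
           integral {0<..} (\<lambda>x. of_real (theta_tail x) * of_real x powr (a - 1))"
proof -
  define c where "c = (\<lambda>k. pi * real (Suc k) ^ 2)"
  let ?G = "\<lambda>k x. complex_of_real (exp (- (c k * x))) * of_real x powr (a - 1)"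
  let ?H = "\<lambda>k x. complex_of_real (exp (- (c k * x))) * of_real x powr (of_real (Re a) - 1)"
  have c: "c k > 0" for k by (simp add: c_def)
  have cpowr: "complex_of_real (c k) powr (- b) = of_real pi powr (- b) * (1 / of_nat (Suc k) powr (2 * b))" for b k
  proof -
    have "complex_of_real (c k) powr (- b) = of_real pi powr (- b) * of_real (real (Suc k) ^ 2) powr (- b)"
      unfolding c_def of_real_mult by (rule powr_times_real) auto
    also have "complex_of_real (real (Suc k) ^ 2) powr (- b) = of_nat (Suc k) powr (- (2 * b))"
    proof -
      have "ln (real (Suc k) ^ 2) = 2 * ln (real (Suc k))"
        by (subst ln_realpow) auto
      hence "Ln (complex_of_real (real (Suc k) ^ 2)) = 2 * Ln (complex_of_real (real (Suc k)))"
        by (simp only: Ln_of_real zero_less_power of_nat_0_less_iff zero_less_Suc) simp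
      thus ?thesis by (simp add: powr_def mult_ac del: of_nat_Suc)
    qed
    finally show ?thesis by (simp add: powr_minus divide_inverse)
  qed
  have G: "?G k absolutely_integrable_on {0<..}"
    "integral {0<..} (?G k) = Gamma a * of_real pi powr (- a) * (1 / of_nat (Suc k) powr (2 * a))" for k
    using Gamma_integral_scaled[of a "c k"] a c by (simp_all add: cpowr)
  have ptw: "(\<lambda>k. exp (- (c k * x))) sums theta_tail x" if "x \<in> {0<..}" for x
    using theta_tail_sums[of x] that by (simp add: c_def)
  have 1: "summable (\<lambda>k. norm (?G k x))" if "x \<in> {0<..}" for x
    using sums_summable[OF sums_mult2[OF ptw[OF that], of "norm (complex_of_real x powr (a - 1))"]]
    by (simp add: norm_mult)
  have 2: "summable (\<lambda>k. integral {0<..} (\<lambda>x. norm (?G k x)))"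
  proof -
    have "integral {0<..} (\<lambda>x. norm (?G k x)) =
        norm (Gamma (complex_of_real (Re a)) * of_real pi powr (- of_real (Re a))) * real (Suc k) powr (- (2 * Re a))" for k
    proof -
      have ni: "(\<lambda>x. norm (?G k x)) integrable_on {0<..}"
        using absolutely_integrable_norm[OF G(1)[of k]] by (simp add: o_def set_lebesgue_integral_eq_integral(1))
      have "complex_of_real (norm (?G k x)) = ?H k x" if "x \<in> {0<..}" for x
      proof -
        have "complex_of_real x powr (of_real (Re a) - 1) = of_real (x powr (Re a - 1))"
          using that by (subst powr_of_real[symmetric]) auto
        thus ?thesis using that by (simp add: norm_mult norm_powr_real_powr)
      qed
      hence "integral {0<..} (?H k) = integral {0<..} (\<lambda>x. complex_of_real (norm (?G k x)))"
        by (intro integral_cong) simp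
      also have "\<dots> = of_real (integral {0<..} (\<lambda>x. norm (?G k x)))"
        by (intro integral_unique has_integral_of_real integrable_integral ni)
      finally have "of_real (integral {0<..} (\<lambda>x. norm (?G k x))) = integral {0<..} (?H k)" by simp
      also have "\<dots> = Gamma (of_real (Re a)) * of_real (c k) powr (- of_real (Re a))"
        using a c by (intro Gamma_integral_scaled) auto
      finally have "norm (complex_of_real (integral {0<..} (\<lambda>x. norm (?G k x)))) =
          norm (Gamma (complex_of_real (Re a)) * (of_real pi powr (- of_real (Re a)) * (1 / of_nat (Suc k) powr (2 * of_real (Re a)))))"
        unfolding cpowr by simp
      moreover have "norm (complex_of_real (integral {0<..} (\<lambda>x. norm (?G k x)))) = integral {0<..} (\<lambda>x. norm (?G k x))"
        unfolding norm_of_real using ni by (intro abs_of_nonneg integral_nonneg) auto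
      moreover have "norm (1 / of_nat (Suc k) powr (2 * complex_of_real (Re a))) = real (Suc k) powr (- (2 * Re a))"
      proof -
        have "norm (of_nat (Suc k) powr (2 * complex_of_real (Re a))) = real (Suc k) powr (2 * Re a)"
          using norm_powr_real_powr[of "of_nat (Suc k)" "2 * complex_of_real (Re a)"] by (simp del: of_nat_Suc)
        thus ?thesis by (simp add: norm_inverse powr_minus divide_inverse del: of_nat_Suc)
      qed
      ultimately show ?thesis by (simp only: norm_mult mult.assoc)
    qed
    moreover have "summable (\<lambda>k. real (Suc k) powr (- (2 * Re a)))"
      using a by (subst summable_Suc_iff) (simp add: summable_real_powr_iff)
    ultimately show ?thesis by (simp add: summable_mult)
  qed
  have eq: "(\<Sum>k. ?G k x) = of_real (theta_tail x) * of_real x powr (a - 1)" if "x \<in> {0<..}" for x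
    using sums_mult2[OF sums_of_real[OF ptw[OF that]], of "complex_of_real x powr (a - 1)"]
    by (simp add: sums_iff)
  have "(\<lambda>x. \<Sum>k. ?G k x) absolutely_integrable_on {0<..}"
    by (rule integral_suminf_on(1)[OF G(1) 1 2])
  thus "(\<lambda>x. of_real (theta_tail x) * of_real x powr (a - 1)) absolutely_integrable_on {0<..}"
    by (subst (asm) set_integrable_cong[OF refl refl eq]) auto
  have "(\<lambda>k. integral {0<..} (?G k)) sums integral {0<..} (\<lambda>x. \<Sum>k. ?G k x)"
    by (rule integral_suminf_on(2)[OF G(1) 1 2])
  also have "integral {0<..} (\<lambda>x. \<Sum>k. ?G k x) = integral {0<..} (\<lambda>x. of_real (theta_tail x) * of_real x powr (a - 1))"
    by (rule integral_cong) (rule eq)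
  finally show "(\<lambda>k. Gamma a * of_real pi powr (- a) * (1 / of_nat (Suc k) powr (2 * a))) sums
           integral {0<..} (\<lambda>x. of_real (theta_tail x) * of_real x powr (a - 1))"
    unfolding G(2) .
qed

definition theta_upper_mellin :: "complex \<Rightarrow> complex" where
  "theta_upper_mellin a = integral {1..} (\<lambda>x. of_real (theta_tail x) * of_real x powr (a - 1))"

text \<open>
  For large exponents this is part of the convergence of the full Mellin integral; smaller exponents
  only decrease the integrand on [1,oo).
\<close>
lemma theta_tail_powr_integrable:
  "(\<lambda>x. theta_tail x * x powr r) absolutely_integrable_on {1..}"
proof -
  define q where "q = max r 0"
  let ?f = "\<lambda>x. complex_of_real (theta_tail x) * of_real x powr (of_real (q + 1) - 1)"
  have "?f absolutely_integrable_on {0<..}"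
    by (rule theta_tail_mellin(1)) (simp add: q_def)
  hence f: "?f absolutely_integrable_on {1..}"
    by (rule set_integrable_subset) auto
  have Re_f: "Re (?f x) = theta_tail x * x powr q" if "x \<in> {1..}" for x
    using that by (simp add: powr_of_real flip: of_real_mult)
  have "(\<lambda>x. Re (?f x)) absolutely_integrable_on {1..}"
    using f by (subst (asm) absolutely_integrable_componentwise_iff) (simp add: Basis_complex_def)
  hence q: "(\<lambda>x. theta_tail x * x powr q) absolutely_integrable_on {1..}"
    by (subst (asm) set_integrable_cong[OF refl refl Re_f]) auto
  show ?thesis
  proof (rule measurable_bounded_by_integrable_imp_absolutely_integrable)
    have 1: "(\<lambda>x. theta_tail x * x powr q) \<in> borel_measurable (lebesgue_on {1..})"
      using q by (subst (asm) absolutely_integrable_measurable) auto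
    have 2: "(\<lambda>x::real. x powr (r - q)) \<in> borel_measurable (lebesgue_on {1..})"
      by (intro continuous_imp_measurable_on_sets_lebesgue continuous_intros) auto
    have "(\<lambda>x. theta_tail x * x powr q * x powr (r - q)) \<in> borel_measurable (lebesgue_on {1..})"
      by (intro borel_measurable_times 1 2)
    thus "(\<lambda>x. theta_tail x * x powr r) \<in> borel_measurable (lebesgue_on {1..})"
      by (subst measurable_cong[where g = "\<lambda>x. theta_tail x * x powr q * x powr (r - q)"])
         (auto simp: powr_add[symmetric])
    show "(\<lambda>x. theta_tail x * x powr q) integrable_on {1..}"
      using q by (rule set_lebesgue_integral_eq_integral)
    show "norm (theta_tail x * x powr r) \<le> theta_tail x * x powr q" if "x \<in> {1..}" for x
      using that theta_tail_nonneg[of x]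
      by (auto simp: abs_mult q_def intro!: mult_left_mono powr_mono)
  qed auto
qed

lemma theta_upper_mellin_holomorphic: "theta_upper_mellin holomorphic_on UNIV"
  unfolding theta_upper_mellin_def
  by (rule mellin_tail_holomorphic) (auto intro: theta_tail_nonneg theta_tail_powr_integrable)

lemma theta_upper_mellin_integrable:
  "(\<lambda>x. of_real (theta_tail x) * of_real x powr (a - 1) :: complex) absolutely_integrable_on {1..}"
proof (rule measurable_bounded_by_integrable_imp_absolutely_integrable)
  have "(\<lambda>x. theta_tail x * x powr 0) \<in> borel_measurable (lebesgue_on {1..})"
    using theta_tail_powr_integrable[of 0] by (subst (asm) absolutely_integrable_measurable) auto
  hence [measurable]: "theta_tail \<in> borel_measurable (lebesgue_on {1..})"
    by (subst measurable_cong[where g = "\<lambda>x. theta_tail x * x powr 0"]) auto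
  have [measurable]: "(\<lambda>x. complex_of_real x powr (a - 1)) \<in> borel_measurable (lebesgue_on {1..})"
    by (intro continuous_imp_measurable_on_sets_lebesgue continuous_intros) auto
  show "(\<lambda>x. of_real (theta_tail x) * of_real x powr (a - 1) :: complex) \<in> borel_measurable (lebesgue_on {1..})"
    by measurable
  show "(\<lambda>x. theta_tail x * x powr (Re a - 1)) integrable_on {1..}"
    using theta_tail_powr_integrable by (rule set_lebesgue_integral_eq_integral)
  show "norm (of_real (theta_tail x) * of_real x powr (a - 1) :: complex) \<le> theta_tail x * x powr (Re a - 1)"
    if "x \<in> {1..}" for x
    using that theta_tail_nonneg[of x] by (simp add: norm_mult norm_powr_real_powr)
qed auto

lemma theta_upper_mellin_cnj:
  "theta_upper_mellin (cnj a) = cnj (theta_upper_mellin a)"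
  unfolding theta_upper_mellin_def integral_cnj
  by (intro integral_cong) (auto simp: cnj_powr)

text \<open>
  Riemann's step: substitute x = 1/u on (0,1] and apply the theta transformation to omega(1/u). The
  theta part reproduces the integral over [1,oo) with a replaced by 1/2 - a, and the elementary part
  (sqrt u - 1)/2 gives the two poles.
\<close>
lemma theta_tail_mellin_split:
  fixes a :: complex
  assumes a: "Re a > 1/2"
  shows "integral {0<..} (\<lambda>x. of_real (theta_tail x) * of_real x powr (a - 1)) =
           theta_upper_mellin a + theta_upper_mellin (1/2 - a) + (1 / (a - 1/2) - 1 / a) / 2"
proof -
  let ?f = "\<lambda>x. complex_of_real (theta_tail x) * of_real x powr (a - 1)"
  have f: "?f absolutely_integrable_on {0<..}" by (rule theta_tail_mellin(1)[OF a])
  hence f1: "?f absolutely_integrable_on {0<..1}" and f2: "?f absolutely_integrable_on {1..}"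
    by (auto intro: set_integrable_subset)
  have "{0<..} = {0<..1} \<union> {1::real..}" by auto
  moreover have "{0<..1} \<inter> {1..} = {1::real}" by auto
  ultimately have "integral {0<..} ?f = integral {0<..1} ?f + integral {1..} ?f"
    using f1 f2 by (simp add: Henstock_Kurzweil_Integration.integral_Un set_lebesgue_integral_eq_integral(1))
  also have "integral {1..} ?f = theta_upper_mellin a"
    by (simp add: theta_upper_mellin_def)
  also have "integral {0<..1} ?f = integral {1..} (\<lambda>u. \<bar>- 1 / u\<^sup>2\<bar> *\<^sub>R ?f (1 / u))"
  proof -
    have img: "(\<lambda>u. 1 / u) ` {1..} = {0<..1::real}"
    proof (intro equalityI subsetI)
      fix y :: real assume "y \<in> {0<..1}"
      thus "y \<in> (\<lambda>u. 1 / u) ` {1..}"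
        by (intro image_eqI[of _ _ "1 / y"]) auto
    qed auto
    have der: "((\<lambda>u. 1 / u) has_real_derivative - 1 / u\<^sup>2) (at u within {1..})" if "u \<in> {1..}" for u :: real
      using that by (auto intro!: derivative_eq_intros simp: power2_eq_square)
    have inj: "inj_on (\<lambda>u. 1 / u) {1::real..}" by (auto simp: inj_on_def)
    have "{1::real..} \<in> sets lebesgue" by simp
    from has_absolute_integral_change_of_variables_real[OF this der inj, of ?f "integral {0<..1} ?f"] f1
    show ?thesis unfolding img by simp
  qed
  also have "\<dots> = integral {1..} (\<lambda>u. of_real (theta_tail u) * of_real u powr ((1/2 - a) - 1)
      + (of_real u powr (- (a - 1/2) - 1) - of_real u powr (- a - 1)) / 2)"
  proof (rule integral_cong)
    fix u :: real assume u: "u \<in> {1..}"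
    have rec: "theta_tail (1 / u) = sqrt u * theta_tail u + (sqrt u - 1) / 2"
      using theta_tail_reciprocal[of "1 / u"] u by (simp add: real_sqrt_divide field_simps)
    have sq: "complex_of_real (sqrt u) = of_real u powr (1/2)"
      using u powr_of_real[of u "1/2"] by (simp add: powr_half_sqrt)
    \<comment> \<open>The factor u^(-2) is the Jacobian of the substitution.\<close>
    have inv: "of_real (1 / u) powr (a - 1) / of_real u ^ 2 = of_real u powr (- a - 1)"
    proof -
      have "of_real (1 / u) powr (a - 1) = of_real u powr (- (a - 1))"
      proof -
        have "Ln (complex_of_real (1 / u)) = of_real (ln (1 / u))"
          using u by (intro Ln_of_real) auto
        also have "\<dots> = - Ln (complex_of_real u)"
          using u by (simp add: Ln_of_real ln_div)
        finally show ?thesis using u unfolding powr_def by (simp add: algebra_simps)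
      qed
      moreover have "of_real u ^ 2 = of_real u powr (2 :: complex)"
        using u by (simp add: powr_numeral)
      ultimately have "of_real (1 / u) powr (a - 1) / of_real u ^ 2 = of_real u powr (- (a - 1) - 2)"
        by (simp only: powr_diff)
      also have "- (a - 1) - 2 = - a - 1" by simp
      finally show ?thesis .
    qed
    have half: "of_real (sqrt u) * of_real u powr (- a - 1) = of_real u powr (1/2 - a - 1)"
      unfolding sq using u by (simp add: powr_add[symmetric] add_ac)
    have "\<bar>- 1 / u\<^sup>2\<bar> *\<^sub>R ?f (1 / u) = of_real (theta_tail (1 / u)) * (of_real (1 / u) powr (a - 1) / of_real u ^ 2)"
      by (simp add: scaleR_conv_of_real)
    also have "\<dots> = of_real (theta_tail (1 / u)) * of_real u powr (- a - 1)"
      unfolding inv ..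
    also have "\<dots> = of_real (theta_tail u) * (of_real (sqrt u) * of_real u powr (- a - 1))
        + (of_real (sqrt u) * of_real u powr (- a - 1) - of_real u powr (- a - 1)) / 2"
      unfolding rec by (simp add: field_simps)
    also have "\<dots> = of_real (theta_tail u) * of_real u powr ((1/2 - a) - 1)
      + (of_real u powr (- (a - 1/2) - 1) - of_real u powr (- a - 1)) / 2"
      unfolding half by simp
    finally show "\<bar>- 1 / u\<^sup>2\<bar> *\<^sub>R ?f (1 / u) = of_real (theta_tail u) * of_real u powr ((1/2 - a) - 1)
      + (of_real u powr (- (a - 1/2) - 1) - of_real u powr (- a - 1)) / 2" .
  qed
  also have "\<dots> = theta_upper_mellin (1/2 - a) + (1 / (a - 1/2) - 1 / a) / 2"
  proof -
    have b: "Re (a - 1/2) > 0" "Re a > 0" using a by auto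
    note I = integral_complex_powr_to_inf[OF b(1)] integral_complex_powr_to_inf[OF b(2)]
    have i: "((\<lambda>x. of_real x powr (- (a - 1/2) - 1)) has_integral 1 / (a - 1/2)) {1..}"
            "((\<lambda>x. of_real x powr (- a - 1)) has_integral 1 / a) {1..}"
      using integrable_integral[OF set_lebesgue_integral_eq_integral(1)[OF I(1)]]
            integrable_integral[OF set_lebesgue_integral_eq_integral(1)[OF I(3)]]
      unfolding I(2) I(4) .
    have "((\<lambda>x. of_real (theta_tail x) * of_real x powr ((1/2 - a) - 1)) has_integral theta_upper_mellin (1/2 - a)) {1..}"
      unfolding theta_upper_mellin_def
      by (intro integrable_integral set_lebesgue_integral_eq_integral(1) theta_upper_mellin_integrable)
    from has_integral_add[OF this has_integral_divide[OF has_integral_diff[OF i], of 2]]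
    show ?thesis by (rule integral_unique)
  qed
  finally show ?thesis by (simp add: add_ac)
qed

text \<open>
  The Mellin identity solved for zeta. The pole term 1/s is absorbed through
  rGamma (s/2) / s = rGamma (s/2 + 1) / 2, so that the formula is visibly holomorphic away from 1.
\<close>
definition zeta_formula :: "complex \<Rightarrow> complex" where
  "zeta_formula s = of_real pi powr (s / 2) *
     (rGamma (s / 2) * (theta_upper_mellin (s / 2) + theta_upper_mellin ((1 - s) / 2) + 1 / (s - 1))
      - rGamma (s / 2 + 1) / 2)"

lemma zeta_formula_holomorphic: "zeta_formula holomorphic_on (- {1})"
proof -
  have E: "(\<lambda>s. theta_upper_mellin (f s)) holomorphic_on (- {1})" if "f holomorphic_on (- {1})" for f
    using holomorphic_on_compose_gen[OF that theta_upper_mellin_holomorphic] by (simp add: o_def)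
  show ?thesis
    unfolding zeta_formula_def by (intro holomorphic_intros E) auto
qed

lemma zeta_formula_eq:
  assumes "s \<noteq> 0"
  shows "zeta_formula s = of_real pi powr (s / 2) * rGamma (s / 2) *
     (theta_upper_mellin (s / 2) + theta_upper_mellin ((1 - s) / 2) + 1 / (s - 1) - 1 / s)"
proof -
  have "rGamma (s / 2 + 1) / 2 = rGamma (s / 2) * (1 / s)"
    using rGamma_plus1[of "s / 2"] assms by (simp add: field_simps)
  thus ?thesis unfolding zeta_formula_def by (simp add: algebra_simps)
qed

lemma Gamma_half_nonzero:
  assumes "Re s > 0" shows "Gamma (s / 2) \<noteq> 0"
  using assms by (subst Gamma_eq_zero_iff) (auto elim!: nonpos_Ints_cases simp: complex_eq_iff)

lemma zeta_formula_sums: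
  assumes s: "Re s > 1"
  shows "(\<lambda>n. 1 / of_nat (Suc n) powr s) sums zeta_formula s"
proof -
  have a: "Re (s / 2) > 1 / 2" using s by simp
  have G: "Gamma (s / 2) \<noteq> 0"
    using s by (intro Gamma_half_nonzero) auto
  have snz: "s \<noteq> 0" using s by auto
  have "(1 / (s / 2 - 1 / 2) - 1 / (s / 2)) / 2 = 1 / (s - 1) - 1 / s"
    by (simp add: diff_divide_distrib[symmetric])
  hence I: "integral {0<..} (\<lambda>x. of_real (theta_tail x) * of_real x powr (s / 2 - 1)) =
        theta_upper_mellin (s / 2) + theta_upper_mellin ((1 - s) / 2) + 1 / (s - 1) - 1 / s"
    using theta_tail_mellin_split[OF a] by (simp add: diff_divide_distrib)
  from sums_mult[OF theta_tail_mellin(2)[OF a], of "of_real pi powr (s / 2) * rGamma (s / 2)"]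
  have "(\<lambda>k. of_real pi powr (s / 2) * rGamma (s / 2) * (Gamma (s / 2) * of_real pi powr (- (s / 2)) * (1 / of_nat (Suc k) powr (2 * (s / 2))))) sums zeta_formula s"
    unfolding I zeta_formula_eq[OF snz] .
  also have "(\<lambda>k. of_real pi powr (s / 2) * rGamma (s / 2) * (Gamma (s / 2) * of_real pi powr (- (s / 2)) * (1 / of_nat (Suc k) powr (2 * (s / 2))))) = (\<lambda>k. 1 / of_nat (Suc k) powr s)"
    using G by (intro ext) (simp add: rGamma_inverse_Gamma powr_minus field_simps)
  finally show ?thesis .
qed

text \<open>
  Existence comes from the formula and uniqueness from the identity theorem on the punctured plane,
  which is connected.
\<close>
lemma zeta_eq_formula: "zeta = (\<lambda>s. if s = 1 then 0 else zeta_formula s)"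
  unfolding zeta_def
proof (rule the_equality, intro conjI allI impI)
  show "(\<lambda>s. if s = 1 then 0 else zeta_formula s) holomorphic_on - {1}"
    by (rule holomorphic_transform[OF zeta_formula_holomorphic]) auto
  show "(\<lambda>n. 1 / of_nat (Suc n) powr s) sums (if s = 1 then 0 else zeta_formula s)" if "Re s > 1" for s
    using zeta_formula_sums[OF that] that by auto
next
  fix f :: "complex \<Rightarrow> complex"
  assume f: "f holomorphic_on - {1} \<and> (\<forall>s. 1 < Re s \<longrightarrow> (\<lambda>n. 1 / of_nat (Suc n) powr s) sums f s) \<and> f 1 = 0"
  have "f s = zeta_formula s" if "s \<noteq> 1" for s
  proof (rule analytic_continuation_open[of "{s. Re s > 1}" "- {1}" f zeta_formula])
    show "{s. Re s > 1} \<noteq> {}" by (auto intro: exI[of _ 2])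
    show "connected (- {1 :: complex})"
      by (rule connected_punctured_universe) simp
    show "f z = zeta_formula z" if "z \<in> {s. Re s > 1}" for z
      using f zeta_formula_sums[of z] that sums_unique2 by blast
  qed (use f that zeta_formula_holomorphic in \<open>auto simp: open_halfspace_Re_gt\<close>)
  thus "f = (\<lambda>s. if s = 1 then 0 else zeta_formula s)" using f by auto
qed simp

text \<open>
  The Gamma factor of h cancels against rGamma, and s (s - 1) clears both poles. The right-hand side
  is invariant under s -> 1 - s, so this contains the functional equation.
\<close>
lemma xi_eq:
  assumes s: "Re s > 0" "s \<noteq> 1"
  shows "xi s = (s * (s - 1) * (theta_upper_mellin (s / 2) + theta_upper_mellin ((1 - s) / 2)) + 1) / 2"
proof -
  have G: "Gamma (s / 2) \<noteq> 0"
    using s by (intro Gamma_half_nonzero) auto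
  have snz: "s \<noteq> 0" using s by auto
  have alg: "1/2 * s * (s - 1) * 1 * 1 * (u + v + p - q) = (s * (s - 1) * (u + v) + s * (s - 1) * (p - q)) / 2"
    for u v p q :: complex
    by (simp add: algebra_simps add_divide_distrib diff_divide_distrib)
  have "xi s = 1/2 * s * (s - 1) * (of_real pi powr (- s / 2) * of_real pi powr (s / 2)) * (Gamma (s / 2) * rGamma (s / 2)) *
      (theta_upper_mellin (s / 2) + theta_upper_mellin ((1 - s) / 2) + 1 / (s - 1) - 1 / s)"
    using s snz unfolding xi_def h_def zeta_eq_formula by (simp add: zeta_formula_eq mult_ac)
  also have "of_real pi powr (- s / 2) * of_real pi powr (s / 2) = (1 :: complex)"
    by (simp add: powr_minus)
  also have "Gamma (s / 2) * rGamma (s / 2) = 1"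
    using G by (simp add: rGamma_inverse_Gamma)
  finally have "xi s = (s * (s - 1) * (theta_upper_mellin (s / 2) + theta_upper_mellin ((1 - s) / 2))
      + s * (s - 1) * (1 / (s - 1) - 1 / s)) / 2"
    by (simp only: alg)
  also have "s * (s - 1) * (1 / (s - 1) - 1 / s) = 1"
    using s snz by (simp add: field_simps)
  finally show ?thesis .
qed

text \<open>
  On the critical line (1 - s)/2 is the conjugate of s/2, so the two values of the entire function
  are conjugate, and s (s - 1) = - |s|^2 is real.
\<close>
lemma Xi_real: "Xi (of_real t) \<in> \<real>"
proof -
  define s where "s = 1/2 + \<i> * of_real t"
  define E where "E = theta_upper_mellin (s / 2)"
  have "(1 - s) / 2 = cnj (s / 2)" by (simp add: s_def complex_eq_iff)
  hence "theta_upper_mellin ((1 - s) / 2) = cnj E"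
    by (simp only: theta_upper_mellin_cnj E_def)
  hence "xi s = (s * (s - 1) * (E + cnj E) + 1) / 2"
    by (subst xi_eq) (auto simp: s_def E_def complex_eq_iff)
  also have "s * (s - 1) = of_real (- (1/4 + t\<^sup>2))"
    by (simp add: s_def complex_eq_iff power2_eq_square)
  also have "E + cnj E = of_real (2 * Re E)"
    by (rule complex_add_cnj)
  finally have "Xi (of_real t) = of_real ((- (1/4 + t\<^sup>2) * (2 * Re E) + 1) / 2)"
    by (simp add: Xi_def s_def)
  thus ?thesis by (metis Reals_of_real)
qed

lemma h_nonzero:
  assumes "Re s > 0" "s \<noteq> 1" shows "h s \<noteq> 0"
  using assms Gamma_half_nonzero[of s] by (auto simp: h_def)

lemma h_holomorphic: "h holomorphic_on {s. Re s > 0}"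
proof -
  have "s / 2 \<notin> \<int>\<^sub>\<le>\<^sub>0" if "Re s > 0" for s :: complex
    using that by (auto elim!: nonpos_Ints_cases simp: complex_eq_iff)
  thus ?thesis unfolding h_def[abs_def] by (intro holomorphic_intros) auto
qed

lemma zeta_holomorphic: "zeta holomorphic_on (- {1})"
  unfolding zeta_eq_formula by (rule holomorphic_transform[OF zeta_formula_holomorphic]) auto

text \<open>
  Rules out the degenerate case in which the order of a zero carries no information.
\<close>
lemma zeta_not_identically_zero: "\<exists>s\<in>- {1}. zeta s \<noteq> 0"
proof (rule ccontr)
  assume "\<not> ?thesis"
  hence z: "zeta s = 0" if "s \<noteq> 1" for s using that by auto
  have "zeta 2 = zeta_formula 2" by (simp add: zeta_eq_formula)
  have "(\<lambda>n. 1 / of_nat (Suc n) powr (2::complex)) sums 0"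
    using zeta_formula_sums[of 2] z[of 2] \<open>zeta 2 = zeta_formula 2\<close> by simp
  hence "(\<lambda>n. Re (1 / of_nat (Suc n) powr (2::complex))) sums Re 0"
    by (rule sums_Re)
  moreover have "Re (1 / of_nat (Suc n) powr (2::complex)) = 1 / real (Suc n) ^ 2" for n
  proof -
    have "of_nat (Suc n) powr (2::complex) = of_real (real (Suc n) ^ 2)"
      by (simp add: powr_numeral del: of_nat_Suc)
    thus ?thesis by (simp add: Re_divide_of_real del: of_nat_Suc of_real_power)
  qed
  ultimately have "(\<lambda>n. 1 / real (Suc n) ^ 2) sums 0" by simp
  thus False
    using suminf_pos[of "\<lambda>n. 1 / real (Suc n) ^ 2"] by (simp add: sums_iff del: of_nat_Suc)
qed

lemma deriv_zeta_nonzero_at_simple_zero: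
  assumes "\<rho> \<noteq> 1" "zorder zeta \<rho> = 1"
  shows "deriv zeta \<rho> \<noteq> 0"
proof -
  obtain r where r: "r > 0" "cball \<rho> r \<subseteq> - {1}" "zor_poly zeta \<rho> holomorphic_on cball \<rho> r"
    "\<forall>w\<in>cball \<rho> r. zeta w = zor_poly zeta \<rho> w * (w - \<rho>) ^ nat (zorder zeta \<rho>) \<and> zor_poly zeta \<rho> w \<noteq> 0"
    using zorder_exist_zero[OF zeta_holomorphic, of \<rho>] zeta_not_identically_zero assms
      connected_punctured_universe[of "1 :: complex"] by auto
  define g where "g = zor_poly zeta \<rho>"
  have g: "g holomorphic_on ball \<rho> r" "g \<rho> \<noteq> 0"
    using r by (auto simp: g_def intro: holomorphic_on_subset)
  have "(g has_field_derivative deriv g \<rho>) (at \<rho>)"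
    using g(1) r(1) by (intro holomorphic_derivI[of _ "ball \<rho> r"]) auto
  hence "((\<lambda>w. g w * (w - \<rho>)) has_field_derivative g \<rho>) (at \<rho>)"
    by (auto intro!: derivative_eq_intros)
  moreover have "\<forall>\<^sub>F w in nhds \<rho>. g w * (w - \<rho>) = zeta w"
    using eventually_nhds_in_open[of "ball \<rho> r" \<rho>] r(1)
    by (auto elim!: eventually_mono simp: r(4) g_def assms(2))
  ultimately have "(zeta has_field_derivative g \<rho>) (at \<rho>)"
    by (subst (asm) DERIV_cong_ev[OF refl _ refl]) auto
  thus ?thesis using g(2) DERIV_imp_deriv by metis
qed

section \<open>The pre-Schwarzian at a simple zero\<close>

text \<open>
  The derivative is a limit of difference quotients along the real axis, and the reals are closed.
\<close>
lemma deriv_real_on_real_axis: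
  fixes f :: "complex \<Rightarrow> complex" and x :: real
  assumes d: "f field_differentiable at (of_real x)"
    and r: "\<forall>\<^sub>F t in nhds x. f (of_real t) \<in> \<real>"
  shows "deriv f (of_real x) \<in> \<real>"
proof -
  have "(f has_field_derivative deriv f (of_real x)) (at (of_real x))"
    using d by (simp add: field_differentiable_derivI)
  hence "((\<lambda>y. (f y - f (of_real x)) / (y - of_real x)) \<longlongrightarrow> deriv f (of_real x)) (at (of_real x))"
    by (simp add: has_field_derivative_iff)
  moreover have "filterlim complex_of_real (at (of_real x)) (at x)"
    by (intro filterlim_atI tendsto_intros) (auto simp: eventually_at_filter)
  ultimately have lim: "((\<lambda>t. (f (of_real t) - f (of_real x)) / (of_real t - of_real x)) \<longlongrightarrow> deriv f (of_real x)) (at x)"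
    by (rule filterlim_compose)
  have fx: "f (of_real x) \<in> \<real>" using r by (rule eventually_nhds_x_imp_x)
  have "\<forall>\<^sub>F t in at x. f (of_real t) \<in> \<real>"
    using r by (simp add: eventually_at_filter eventually_mono)
  hence "\<forall>\<^sub>F t in at x. (f (of_real t) - f (of_real x)) / (of_real t - of_real x) \<in> \<real>"
    by eventually_elim (use fx in auto)
  from Lim_in_closed_set[OF closed_complex_Reals this _ lim] show ?thesis by simp
qed

text \<open>
  With x = h z, the product rule gives x' = h' z + e and x'' = h'' z + h' z' + e'. Since z vanishes at
  rho, the values there are x' = e = h z', x'' = e' + h' z', and the third derivative of x is e'' + 2 h'' z' + h' z''. Division
  by x' expresses everything through the logarithmic derivatives L of h and M of e; the second
  derivative of z is eliminated by e' = h' z' + h z''.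
\<close>
lemma deriv_log_deriv_product_at_simple_zero:
  fixes h z :: "complex \<Rightarrow> complex"
  assumes S: "open S" "\<rho> \<in> S" and h: "h holomorphic_on S" and z: "z holomorphic_on S"
    and nz: "h \<rho> \<noteq> 0" "z \<rho> = 0" "deriv z \<rho> \<noteq> 0"
    and x_def: "x = (\<lambda>s. h s * z s)" and e_def: "e = (\<lambda>s. h s * deriv z s)"
    and L_def: "L = (\<lambda>s. deriv h s / h s)" and M_def: "M = (\<lambda>s. deriv e s / e s)"
  shows "deriv x \<rho> \<noteq> 0"
    and "deriv (deriv x) \<rho> / deriv x \<rho> = M \<rho> + L \<rho>"
    and "deriv (\<lambda>s. deriv (deriv x) s / deriv x s) \<rho> = deriv M \<rho> + 2 * deriv L \<rho> - L \<rho> * M \<rho>"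
proof -
  have e: "e holomorphic_on S"
    unfolding e_def by (intro holomorphic_intros h z S)
  have D: "(f has_field_derivative deriv f s) (at s)" if "f holomorphic_on S" "s \<in> S" for f s
    using that S by (intro holomorphic_derivI)
  note D0 = D[OF h] D[OF z] D[OF e]
  note D1 = D[OF holomorphic_deriv[OF h S(1)]] D[OF holomorphic_deriv[OF z S(1)]] D[OF holomorphic_deriv[OF e S(1)]]
  note D2 = D[OF holomorphic_deriv[OF holomorphic_deriv[OF h S(1)] S(1)]]
  have x1: "deriv x s = deriv h s * z s + e s" if "s \<in> S" for s
    unfolding x_def e_def using that
    by (intro DERIV_imp_deriv) (auto intro!: derivative_eq_intros D0)
  have x1': "(deriv x has_field_derivative deriv (deriv h) s * z s + deriv h s * deriv z s + deriv e s) (at s)"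
    if "s \<in> S" for s
  proof (rule has_field_derivative_transform_within_open[OF _ S(1) that])
    show "((\<lambda>s. deriv h s * z s + e s) has_field_derivative
        deriv (deriv h) s * z s + deriv h s * deriv z s + deriv e s) (at s)"
      using that by (auto intro!: derivative_eq_intros D0 D1)
  qed (simp add: x1)
  have x2: "deriv (deriv x) s = deriv (deriv h) s * z s + deriv h s * deriv z s + deriv e s" if "s \<in> S" for s
    using x1'[OF that] by (rule DERIV_imp_deriv)
  have x2': "(deriv (deriv x) has_field_derivative
      2 * deriv (deriv h) \<rho> * deriv z \<rho> + deriv h \<rho> * deriv (deriv z) \<rho> + deriv (deriv e) \<rho>) (at \<rho>)"
  proof (rule has_field_derivative_transform_within_open[OF _ S])
    show "((\<lambda>s. deriv (deriv h) s * z s + deriv h s * deriv z s + deriv e s) has_field_derivative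
        2 * deriv (deriv h) \<rho> * deriv z \<rho> + deriv h \<rho> * deriv (deriv z) \<rho> + deriv (deriv e) \<rho>) (at \<rho>)"
      using S by (auto intro!: derivative_eq_intros D0 D1 D2 simp: nz)
  qed (simp add: x2)
  have e1: "deriv e \<rho> = deriv h \<rho> * deriv z \<rho> + h \<rho> * deriv (deriv z) \<rho>"
    unfolding e_def using S
    by (intro DERIV_imp_deriv) (auto intro!: derivative_eq_intros D0 D1)
  have e_nz: "e \<rho> \<noteq> 0" using nz by (simp add: e_def)
  have x_rho: "deriv x \<rho> = e \<rho>" using x1 S nz by simp
  show "deriv x \<rho> \<noteq> 0" using x_rho e_nz by simp
  show "deriv (deriv x) \<rho> / deriv x \<rho> = M \<rho> + L \<rho>"
    unfolding x_rho x2[OF S(2)] M_def L_def using nz by (simp add: e_def field_simps)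
  have dQ: "deriv (\<lambda>s. deriv f s / f s) \<rho> = (deriv (deriv f) \<rho> * f \<rho> - deriv f \<rho> * deriv f \<rho>) / (f \<rho> * f \<rho>)"
    if "f holomorphic_on S" "f \<rho> \<noteq> 0" for f
    using D[OF that(1) S(2)] D[OF holomorphic_deriv[OF that(1) S(1)] S(2)] that(2)
    by (intro DERIV_imp_deriv) (auto intro!: derivative_eq_intros)
  have x_holo: "x holomorphic_on S" unfolding x_def by (intro holomorphic_intros h z)
  have "deriv (\<lambda>s. deriv (deriv x) s / deriv x s) \<rho> =
      ((2 * deriv (deriv h) \<rho> * deriv z \<rho> + deriv h \<rho> * deriv (deriv z) \<rho> + deriv (deriv e) \<rho>) * e \<rho>
       - (deriv h \<rho> * deriv z \<rho> + deriv e \<rho>) * (deriv h \<rho> * deriv z \<rho> + deriv e \<rho>)) / (e \<rho> * e \<rho>)"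
    using dQ[OF holomorphic_deriv[OF x_holo S(1)]] DERIV_imp_deriv[OF x2'] x2[OF S(2)] e_nz nz
    by (simp add: x_rho)
  also have "\<dots> = deriv M \<rho> + 2 * deriv L \<rho> - L \<rho> * M \<rho>"
    unfolding M_def L_def dQ[OF e e_nz] dQ[OF h nz(1)]
    unfolding e1 using nz(1,3) by (simp add: e_def divide_simps) (simp add: algebra_simps)
  finally show "deriv (\<lambda>s. deriv (deriv x) s / deriv x s) \<rho> = deriv M \<rho> + 2 * deriv L \<rho> - L \<rho> * M \<rho>" .
qed

text \<open>
  A domain containing the critical line on which h and zeta are holomorphic: it avoids the poles of
  Gamma (s/2) and the pole of zeta.
\<close>
definition punctured_right_half_plane :: "complex set" where
  "punctured_right_half_plane = {s. 0 < Re s} - {1}"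

lemma open_punctured_right_half_plane: "open punctured_right_half_plane"
  unfolding punctured_right_half_plane_def by (intro open_Diff open_halfspace_Re_gt) auto

theorem theorem2:
  fixes \<rho> :: complex and \<gamma> :: real
  assumes RH: "Riemann_Hypothesis"
    and rho: "\<rho> = 1/2 + \<i> * of_real \<gamma>"
    and zero: "zeta \<rho> = 0"
    and simple: "zorder zeta \<rho> = 1"
  shows "- deriv (pre_Schwarzian Xi) (of_real \<gamma>) =
    of_real (Re (deriv (\<lambda>s. deriv eta s / eta s) \<rho>)
      + (Re (deriv h \<rho> / h \<rho>))\<^sup>2
      + Im (deriv eta \<rho> / eta \<rho>) * Im (deriv h \<rho> / h \<rho>)
      + 2 * Re (deriv (\<lambda>s. deriv h s / h s) \<rho>))"
proof -
  define L where "L = (\<lambda>s. deriv h s / h s)"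
  define M where "M = (\<lambda>s. deriv eta s / eta s)"
  let ?S = punctured_right_half_plane
  have rho_S: "\<rho> \<in> ?S" and rho1: "\<rho> \<noteq> 1"
    by (auto simp: punctured_right_half_plane_def rho complex_eq_iff)
  have h_holo: "h holomorphic_on ?S"
    by (rule holomorphic_on_subset[OF h_holomorphic]) (auto simp: punctured_right_half_plane_def)
  have zeta_holo: "zeta holomorphic_on ?S"
    by (rule holomorphic_on_subset[OF zeta_holomorphic]) (auto simp: punctured_right_half_plane_def)
  have h_rho: "h \<rho> \<noteq> 0" using rho_S by (intro h_nonzero) (auto simp: punctured_right_half_plane_def)
  have xi_fun: "xi = (\<lambda>s. h s * zeta s)" and eta_fun: "eta = (\<lambda>s. h s * deriv zeta s)"
    by (auto simp: xi_def eta_def)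
  have xi_holo: "xi holomorphic_on ?S"
    unfolding xi_fun by (intro holomorphic_intros h_holo zeta_holo)
  note xi1_holo = holomorphic_deriv[OF xi_holo open_punctured_right_half_plane]
  note xi2_holo = holomorphic_deriv[OF xi1_holo open_punctured_right_half_plane]
  note local = deriv_log_deriv_product_at_simple_zero[OF open_punctured_right_half_plane rho_S h_holo zeta_holo
      h_rho zero deriv_zeta_nonzero_at_simple_zero[OF rho1 simple] xi_fun eta_fun L_def M_def]

  define c where "c = (\<lambda>t. 1/2 + \<i> * t)"
  define U where "U = c -` ?S"
  have c_deriv: "(c has_field_derivative \<i>) (at t)" for t
    unfolding c_def by (auto intro!: derivative_eq_intros)
  have U: "open U"
    unfolding U_def using open_punctured_right_half_plane
    by (rule open_vimage) (auto simp: c_def intro!: continuous_intros)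
  have real_U: "complex_of_real t \<in> U" for t
    by (auto simp: U_def c_def punctured_right_half_plane_def complex_eq_iff)
  have chain: "((\<lambda>t. f (c t)) has_field_derivative \<i> * deriv f (c t)) (at t)"
    if "f holomorphic_on ?S" "t \<in> U" for f t
  proof -
    have "(f has_field_derivative deriv f (c t)) (at (c t))"
      using that open_punctured_right_half_plane by (intro holomorphic_derivI) (auto simp: U_def)
    from DERIV_chain2[OF this c_deriv] show ?thesis by (simp add: mult.commute)
  qed
  have Xi_fun: "Xi = (\<lambda>t. xi (c t))" by (simp add: Xi_def c_def fun_eq_iff)
  have Xi1: "deriv Xi t = \<i> * deriv xi (c t)" if "t \<in> U" for t
    unfolding Xi_fun by (rule DERIV_imp_deriv[OF chain[OF xi_holo that]])
  have Xi1': "(deriv Xi has_field_derivative \<i> * (\<i> * deriv (deriv xi) (c t))) (at t)" if "t \<in> U" for t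
    by (rule has_field_derivative_transform_within_open[OF DERIV_cmult[OF chain[OF xi1_holo that]] U that])
       (simp add: Xi1)
  have Xi2: "deriv (deriv Xi) t = - deriv (deriv xi) (c t)" if "t \<in> U" for t
    using DERIV_imp_deriv[OF Xi1'[OF that]] by (simp add: mult.assoc[symmetric])
  have Xi2': "(deriv (deriv Xi) has_field_derivative - (\<i> * deriv (deriv (deriv xi)) (c t))) (at t)"
    if "t \<in> U" for t
    by (rule has_field_derivative_transform_within_open[OF DERIV_minus[OF chain[OF xi2_holo that]] U that])
       (simp add: Xi2)
  \<comment> \<open>Along c each derivative contributes a factor i, so the logarithmic derivative of Xi' is i times that of xi'.\<close>
  have PXi: "pre_Schwarzian Xi t = \<i> * (deriv (deriv xi) (c t) / deriv xi (c t))" if "t \<in> U" for t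
    using that by (cases "deriv xi (c t) = 0") (simp_all add: pre_Schwarzian_def Xi1 Xi2 divide_simps)
  have c_gamma: "c (of_real \<gamma>) = \<rho>" by (simp add: c_def rho)

  have real0: "Xi (of_real t) \<in> \<real>" for t by (rule Xi_real)
  have real1: "deriv Xi (of_real t) \<in> \<real>" for t
    using chain[OF xi_holo real_U] real0
    by (intro deriv_real_on_real_axis) (auto simp: field_differentiable_def Xi_fun)
  have real2: "deriv (deriv Xi) (of_real t) \<in> \<real>" for t
    using Xi1'[OF real_U] real1
    by (intro deriv_real_on_real_axis) (auto simp: field_differentiable_def)
  have realP: "pre_Schwarzian Xi (of_real t) \<in> \<real>" for t
    using real1 real2 by (simp add: pre_Schwarzian_def)

  let ?Q = "\<lambda>s. deriv (deriv xi) s / deriv xi s"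
  have "(?Q has_field_derivative deriv ?Q \<rho>) (at \<rho>)"
  proof -
    have "?Q field_differentiable at \<rho>"
      using xi1_holo xi2_holo open_punctured_right_half_plane rho_S local(1)
      by (intro field_differentiable_divide holomorphic_on_imp_differentiable_at) auto
    thus ?thesis by (simp add: field_differentiable_derivI)
  qed
  hence "((\<lambda>t. \<i> * ?Q (c t)) has_field_derivative \<i> * (deriv ?Q \<rho> * \<i>)) (at (of_real \<gamma>))"
    by (intro DERIV_cmult DERIV_chain2[OF _ c_deriv]) (simp add: c_gamma)
  hence P': "(pre_Schwarzian Xi has_field_derivative \<i> * (deriv ?Q \<rho> * \<i>)) (at (of_real \<gamma>))"
    by (rule has_field_derivative_transform_within_open[OF _ U real_U]) (simp add: PXi)
  have P_deriv: "- deriv (pre_Schwarzian Xi) (of_real \<gamma>) = deriv ?Q \<rho>"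
    using DERIV_imp_deriv[OF P'] by (simp add: mult_ac)
  have "deriv (pre_Schwarzian Xi) (of_real \<gamma>) \<in> \<real>"
    using P' realP by (intro deriv_real_on_real_axis) (auto simp: field_differentiable_def)
  hence Q_real: "deriv ?Q \<rho> \<in> \<real>"
    using P_deriv by (metis Reals_minus)
  \<comment> \<open>Reality of P Xi itself links the real parts of M and L.\<close>
  have "\<i> * (M \<rho> + L \<rho>) \<in> \<real>"
    using realP[of \<gamma>] by (simp add: PXi[OF real_U] c_gamma local(2))
  hence Re_M: "Re (M \<rho>) = - Re (L \<rho>)" by (simp add: complex_is_Real_iff)
  have "- deriv (pre_Schwarzian Xi) (of_real \<gamma>) = of_real (Re (deriv ?Q \<rho>))"
    unfolding P_deriv using Q_real by simp
  also have "Re (deriv ?Q \<rho>) = Re (deriv M \<rho>) + 2 * Re (deriv L \<rho>) - (Re (L \<rho>) * Re (M \<rho>) - Im (L \<rho>) * Im (M \<rho>))"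
    unfolding local(3) by simp
  also have "\<dots> = Re (deriv M \<rho>) + (Re (L \<rho>))\<^sup>2 + Im (M \<rho>) * Im (L \<rho>) + 2 * Re (deriv L \<rho>)"
    by (simp add: Re_M power2_eq_square)
  finally show ?thesis unfolding L_def M_def .
qed

end
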